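(* Let $q=e^{2\pi i\tau}$ with $\Im\tau>0$, let $\eta(\tau)=q^{1/24}\prod_{j\ge1}(1-q^j)$ and $P(q)=1-24\sum_{j\ge1}\frac{jq^j}{1-q^j}$. Define $$z=\tfrac14\bigl(6P(q^{12})-3P(q^6)+2P(q^4)-P(q^2)\bigr)+2\eta(2\tau)\eta(4\tau)\eta(6\tau)\eta(12\tau),\qquad x=\frac{\eta(2\tau)\eta(4\tau)\eta(6\tau)\eta(12\tau)}{z}.$$ Then, for $q$ in a neighborhood of $0$, $$q\frac{dx}{dq}=z\,x\,\sqrt{(1+4x)(1-4x)(1-8x)},$$ where the square root is the branch equal to $1$ at $x=0$. *)

theory Defs
  imports "HOL-Analysis.Analysis"
begin

definition nome :: "complex \<Rightarrow> complex" where
  "nome \<tau> = exp (2 * of_real pi * \<i> * \<tau>)"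

text \<open>The factor \<open>q\<^bsup>1/24\<^esup>\<close> is read as \<open>exp (2\<pi>i\<tau>/24)\<close>, so \<open>\<eta>\<close> is a function of \<open>\<tau>\<close> rather
  than of \<open>q\<close>.  The infinite product and sum are shifted to start at index 0.\<close>

definition dedekind_eta :: "complex \<Rightarrow> complex" where
  "dedekind_eta \<tau> = exp (2 * of_real pi * \<i> * \<tau> / 24) * (\<Prod>j. 1 - nome \<tau> ^ Suc j)"

definition ramanujan_P :: "complex \<Rightarrow> complex" where
  "ramanujan_P q = 1 - 24 * (\<Sum>j. of_nat (Suc j) * q ^ Suc j / (1 - q ^ Suc j))"

definition eta_prod :: "complex \<Rightarrow> complex" where
  "eta_prod \<tau> = dedekind_eta (2 * \<tau>) * dedekind_eta (4 * \<tau>) * dedekind_eta (6 * \<tau>) *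
     dedekind_eta (12 * \<tau>)"

definition z_fun :: "complex \<Rightarrow> complex" where
  "z_fun \<tau> = (let q = nome \<tau> in
     1 / 4 * (6 * ramanujan_P (q ^ 12) - 3 * ramanujan_P (q ^ 6) + 2 * ramanujan_P (q ^ 4)
       - ramanujan_P (q ^ 2)) + 2 * eta_prod \<tau>)"

definition x_fun :: "complex \<Rightarrow> complex" where
  "x_fun \<tau> = eta_prod \<tau> / z_fun \<tau>"

end

theory Submission
  imports Defs "HOL-Complex_Analysis.Complex_Analysis"
begin

text \<open>
  Put \<open>Q = q\<^sup>2\<close>, \<open>D = Q d/dQ\<close>, \<open>f = \<eta>(2\<tau>)\<eta>(4\<tau>)\<eta>(6\<tau>)\<eta>(12\<tau>)\<close>, so that \<open>h = f\<^sup>2\<close> is a function of \<open>Q\<close>, and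
  \<open>E = z - 2f\<close>.  The claim is equivalent to the existence of two further Eisenstein series \<open>S, T\<close> of
  weight 2 with \<open>E\<^sup>2 - 4h = S\<^sup>2\<close>, \<open>E\<^sup>2 - 36h = T\<^sup>2\<close> and \<open>2 DE = (D log h) E - S T\<close>; the root is then
  \<open>S T / z\<^sup>2\<close>.

  All of this lives in the ring generated by four eta quotients \<open>a, b, c, d\<close> of weight 1 with
  \<open>a b c d = h\<close>, namely \<open>E = b c + a d = a b + 9 c d\<close>, \<open>S = b c - a d\<close>, \<open>T = a b - 9 c d\<close>.  The
  classical identity expressing \<open>\<wp>(x) - \<wp>(y)\<close> as a quotient of theta functions, evaluated at
  \<open>x, y \<in> {-1, \<omega>, -\<omega>}\<close> with \<open>\<omega>\<close> a primitive cube root of unity, gives \<open>a\<^sup>2\<close>, \<open>a b\<close>, \<open>a c\<close> as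
  combinations of \<open>P(Q), P(Q\<^sup>2), P(Q\<^sup>3), P(Q\<^sup>6)\<close>, whence \<open>9 c = a + 8 b\<close>.  Logarithmic
  derivatives of eta quotients are again such combinations, so differentiating this relation yields
  \<open>c (b - a)\<close>, and then \<open>b - a\<close> and \<open>9 d\<close> satisfy the same first order differential equation and
  agree to first order at \<open>Q = 0\<close>.
\<close>

section \<open>Holomorphic infinite products and sums\<close>

text \<open>The Weierstrass test makes the partial products converge uniformly on compact subsets of
  \<open>A\<close>. So the limit is holomorphic, and logarithmic derivatives may be taken factor by
  factor at any point where no factor vanishes.\<close>

lemma
  fixes f :: "nat \<Rightarrow> complex \<Rightarrow> complex"
  assumes A: "open A" and holo: "\<And>k. f k holomorphic_on A" and M: "summable M"
    and bound: "\<And>k x. x \<in> A \<Longrightarrow> norm (f k x - 1) \<le> M k"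
  shows holomorphic_on_prodinf: "(\<lambda>x. \<Prod>k. f k x) holomorphic_on A"
    and logderiv_prodinf_sums:
      "\<lbrakk>x \<in> A; \<And>k. f k x \<noteq> 0\<rbrakk> \<Longrightarrow>
        (\<lambda>k. deriv (f k) x / f k x) sums (deriv (\<lambda>x. \<Prod>k. f k x) x / (\<Prod>k. f k x))"
proof -
  have conv: "convergent_prod (\<lambda>k. f k x)" if "x \<in> A" for x
  proof -
    have "summable (\<lambda>k. norm (f k x - 1))"
      by (rule summable_comparison_test'[OF M, of 0]) (use bound that in auto)
    then show ?thesis
      by (intro abs_convergent_prod_imp_convergent_prod summable_imp_abs_convergent_prod)
  qed
  have lim: "uniform_limit K (\<lambda>n x. \<Prod>k<n. f k x) (\<lambda>x. \<Prod>k. f k x) sequentially"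
    if K: "compact K" "K \<subseteq> A" for K
  proof -
    have "uniformly_convergent_on K (\<lambda>n x. \<Prod>k<n. f k x)"
    proof (rule uniformly_convergent_on_prod')
      show "continuous_on K (f n)" for n
        using holo K(2) by (meson continuous_on_subset holomorphic_on_imp_continuous_on)
      show "uniformly_convergent_on K (\<lambda>N x. \<Sum>n<N. norm (f n x - 1))"
        by (rule Weierstrass_m_test'[OF _ M]) (use bound K(2) in auto)
    qed (use K in auto)
    then obtain l where l: "uniform_limit K (\<lambda>n x. \<Prod>k<n. f k x) l sequentially"
      by (auto simp: uniformly_convergent_on_def)
    have "l x = (\<Prod>k. f k x)" if "x \<in> K" for x
    proof -
      \<comment> \<open>\<open>convergent_prod_LIMSEQ\<close> speaks of products over
        \<open>{..n}\<close>, hence the shift to \<open>Suc n\<close>.\<close>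
      have "(\<lambda>n. \<Prod>k<Suc n. f k x) \<longlonglongrightarrow> l x"
        by (subst filterlim_sequentially_Suc, rule tendsto_uniform_limitI[OF l that])
      moreover have "(\<lambda>n. \<Prod>k<Suc n. f k x) \<longlonglongrightarrow> (\<Prod>k. f k x)"
        using convergent_prod_LIMSEQ[OF conv, of x] that K(2) by (auto simp: lessThan_Suc_atMost)
      ultimately show ?thesis by (rule LIMSEQ_unique)
    qed
    with l show ?thesis by (simp cong: uniform_limit_cong')
  qed
  show "(\<lambda>x. \<Prod>k. f k x) holomorphic_on A"
  proof (rule holomorphic_uniform_sequence[OF A])
    show "(\<lambda>x. \<Prod>k<n. f k x) holomorphic_on A" for n
      by (intro holomorphic_intros holo)
    show "\<exists>d>0. cball x d \<subseteq> A \<and> uniform_limit (cball x d) (\<lambda>n x. \<Prod>k<n. f k x) (\<lambda>x. \<Prod>k. f k x)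
        sequentially" if "x \<in> A" for x
      using A that lim[OF compact_cball] by (meson open_contains_cball)
  qed
  assume x: "x \<in> A" and nz: "\<And>k. f k x \<noteq> 0"
  from A x obtain d where d: "d > 0" "cball x d \<subseteq> A"
    by (meson open_contains_cball)
  show "(\<lambda>k. deriv (f k) x / f k x) sums (deriv (\<lambda>x. \<Prod>k. f k x) x / (\<Prod>k. f k x))"
  proof (rule logderiv_prodinf_complex_uniform_limit)
    show "uniform_limit (ball x d) (\<lambda>n x. \<Prod>k<n. f k x) (\<lambda>x. \<Prod>k. f k x) sequentially"
      using lim[OF compact_cball d(2)] by (rule uniform_limit_on_subset) auto
    show "f k holomorphic_on ball x d" for k
      using holo d(2) by (meson ball_subset_cball holomorphic_on_subset)
    show "(\<Prod>k. f k x) \<noteq> 0"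
      by (rule prodinf_nonzero[OF conv[OF x] nz])
  qed (use d in auto)
qed

lemma holomorphic_on_suminf:
  fixes f :: "nat \<Rightarrow> complex \<Rightarrow> complex"
  assumes A: "open A" and holo: "\<And>k. f k holomorphic_on A" and M: "summable M"
    and bound: "\<And>k x. x \<in> A \<Longrightarrow> norm (f k x) \<le> M k"
  shows "(\<lambda>x. \<Sum>k. f k x) holomorphic_on A"
proof (rule holomorphic_uniform_sequence[OF A])
  show "(\<lambda>x. \<Sum>k<n. f k x) holomorphic_on A" for n
    by (intro holomorphic_intros holo)
  have lim: "uniform_limit A (\<lambda>n x. \<Sum>k<n. f k x) (\<lambda>x. \<Sum>k. f k x) sequentially"
    by (rule Weierstrass_m_test[OF _ M]) (use bound in auto)
  show "\<exists>d>0. cball x d \<subseteq> A \<and> uniform_limit (cball x d) (\<lambda>n x. \<Sum>k<n. f k x) (\<lambda>x. \<Sum>k. f k x)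
      sequentially" if "x \<in> A" for x
    using A that uniform_limit_on_subset[OF lim] by (meson open_contains_cball)
qed

text \<open>Serves \<open>dsum\<close>, for which a uniform majorant is available only on strictly
  smaller balls.\<close>

lemma holomorphic_on_ball_exhaust:
  assumes "\<And>r. r < R \<Longrightarrow> f holomorphic_on ball 0 r"
  shows "f holomorphic_on ball (0::complex) R"
proof -
  have "f field_differentiable at x" if x: "norm x < R" for x
  proof -
    obtain r where "norm x < r" "r < R" using dense[OF x] by blast
    then show ?thesis
      by (intro holomorphic_on_imp_differentiable_at[OF assms]) auto
  qed
  then show ?thesis by (auto simp: holomorphic_on_def field_differentiable_at_within)
qed

section \<open>Theta functions and the Weierstrass function in multiplicative form\<close>

text \<open>The Pochhammer product (xp; p) at infinity. Starting at exponent 1 keeps the factor 1 -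
  x out, so that \<open>qprod p 1\<close> is nonzero for \<open>norm p < 1\<close>.\<close>

definition qprod :: "complex \<Rightarrow> complex \<Rightarrow> complex" where
  "qprod p x = (\<Prod>j. 1 - x * p ^ Suc j)"

text \<open>Multiplicatively, \<open>v/(1 - v)\<^sup>2\<close> is the principal part of \<open>\<wp>\<close>.\<close>

definition dpole :: "complex \<Rightarrow> complex" where
  "dpole v = v / (1 - v)\<^sup>2"

definition dsum :: "complex \<Rightarrow> complex \<Rightarrow> complex" where
  "dsum p x = (\<Sum>j. dpole (x * p ^ Suc j))"

text \<open>The Jacobi theta function in multiplicative form, up to the factor
  \<open>qprod p 1\<close> of the triple product; it vanishes at the integer powers of
  \<open>p\<close>.\<close>

definition theta :: "complex \<Rightarrow> complex \<Rightarrow> complex" where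
  "theta p x = (1 - x) * qprod p x * qprod p (1 / x)"

text \<open>The sum of \<open>dpole (x * p^n)\<close> over all integers n, with negative n folded
  back by \<open>dpole (1 / v) = dpole v\<close>. It is the Weierstrass function up to scaling and
  an additive constant, which cancels in differences.\<close>

definition wp :: "complex \<Rightarrow> complex \<Rightarrow> complex" where
  "wp p x = dpole x + dsum p x + dsum p (1 / x)"

lemma summable_const_power_Suc:
  fixes r :: real
  assumes "0 \<le> r" "r < 1"
  shows "summable (\<lambda>k. c * r ^ Suc k)"
  using assms by (intro summable_mult) (simp add: summable_geometric summable_Suc_iff)

lemma qprod_factor_bound:
  fixes p x :: complex
  assumes "norm x \<le> r"
  shows "norm (1 - x * p ^ Suc k - 1) \<le> r * norm p ^ Suc k"
  using mult_right_mono[OF assms, of "norm p ^ Suc k"] by (simp add: norm_mult norm_power)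

lemma convergent_prod_qprod:
  fixes p x :: complex
  assumes "norm p < 1"
  shows "convergent_prod (\<lambda>j. 1 - x * p ^ Suc j)"
proof (rule abs_convergent_prod_imp_convergent_prod[OF summable_imp_abs_convergent_prod])
  show "summable (\<lambda>j. norm (1 - x * p ^ Suc j - 1))"
    using summable_const_power_Suc[of "norm p" "norm x"] assms by (simp add: norm_mult norm_power)
qed

lemma qprod_holomorphic:
  assumes "norm p < 1"
  shows "qprod p holomorphic_on A"
proof -
  have "qprod p holomorphic_on ball 0 r" for r
    unfolding qprod_def[abs_def]
  proof (rule holomorphic_on_prodinf)
    show "summable (\<lambda>k. r * norm p ^ Suc k)"
      by (rule summable_const_power_Suc) (use assms in auto)
    show "norm (1 - x * p ^ Suc k - 1) \<le> r * norm p ^ Suc k" if "x \<in> ball 0 r" for x k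
      by (rule qprod_factor_bound) (use that in simp)
  qed (auto intro!: holomorphic_intros)
  then have "qprod p field_differentiable at x" for x
    by (rule holomorphic_on_imp_differentiable_at[of _ "ball 0 (norm x + 1)"]) auto
  then show ?thesis by (auto simp: holomorphic_on_def field_differentiable_at_within)
qed

lemma qprod_rec:
  assumes "norm p < 1"
  shows "qprod p x = (1 - p * x) * qprod p (p * x)"
proof (cases "1 - p * x = 0")
  \<comment> \<open>Splitting off an initial segment of an infinite product requires nonzero
    factors, so a vanishing first factor is treated apart: both sides are then 0.\<close>
  case True
  then have "\<exists>j. 1 - x * p ^ Suc j = 0" by (intro exI[of _ 0]) (simp add: mult.commute)
  then have "qprod p x = 0"
    using has_prod_eq_0_iff[OF convergent_prod_has_prod[OF convergent_prod_qprod[OF assms, of x]]]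
    by (auto simp: qprod_def image_iff)
  with True show ?thesis by simp
next
  case False
  then have "qprod p x = (\<Prod>j. 1 - x * p ^ Suc (j + 1)) * (\<Prod>j<1. 1 - x * p ^ Suc j)"
    unfolding qprod_def
    by (intro prodinf_split_initial_segment convergent_prod_qprod assms) (auto simp: mult.commute)
  then show ?thesis by (simp add: qprod_def algebra_simps)
qed

lemma power_Suc_norm_less:
  fixes p x :: complex
  assumes "norm p < 1" "norm (x * p) < 1"
  shows "norm (x * p ^ Suc j) < 1"
proof -
  have "norm (x * p ^ Suc j) = norm (x * p) * norm p ^ j"
    by (simp add: norm_mult norm_power)
  also have "\<dots> \<le> norm (x * p) * 1"
    using assms by (intro mult_left_mono power_le_one) auto
  finally show ?thesis using assms by simp
qed

lemma qprod_nonzero: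
  assumes "norm p < 1" "norm (x * p) < 1"
  shows "qprod p x \<noteq> 0"
  unfolding qprod_def using power_Suc_norm_less[OF assms]
  by (intro prodinf_nonzero convergent_prod_qprod assms) (metis eq_iff_diff_eq_0 norm_one order_less_irrefl)

text \<open>All the points \<open>x * p ^ Suc j\<close> have norm at most \<open>s\<close>, so the
  denominators stay away from 0 and a geometric majorant results.\<close>

lemma dpole_bound:
  assumes "norm (x * p) \<le> s" "s < 1" "norm p < 1"
  shows "norm (dpole (x * p ^ Suc j)) \<le> norm x / (1 - s)\<^sup>2 * norm p ^ Suc j"
proof -
  have "norm (x * p ^ Suc j) = norm (x * p) * norm p ^ j"
    by (simp add: norm_mult norm_power)
  also have "\<dots> \<le> norm (x * p) * 1"
    using assms by (intro mult_left_mono power_le_one) auto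
  finally have "1 - s \<le> 1 - norm (x * p ^ Suc j)" using assms by linarith
  also have "\<dots> \<le> norm (1 - x * p ^ Suc j)"
    by (metis norm_one norm_triangle_ineq2)
  finally have "(1 - s)\<^sup>2 \<le> norm (1 - x * p ^ Suc j) ^ 2"
    using assms by (intro power_mono) auto
  moreover have "(1 - s)\<^sup>2 > 0" using assms by simp
  ultimately have "norm (x * p ^ Suc j) / norm (1 - x * p ^ Suc j) ^ 2 \<le> norm (x * p ^ Suc j) / (1 - s)\<^sup>2"
    by (intro divide_left_mono mult_pos_pos) auto
  then show ?thesis by (simp add: dpole_def norm_divide norm_mult norm_power)
qed

lemma summable_dsum:
  assumes "norm p < 1" "norm (x * p) < 1"
  shows "summable (\<lambda>j. dpole (x * p ^ Suc j))"
  by (rule summable_comparison_test'[where N = 0,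
        OF summable_const_power_Suc[of "norm p" "norm x / (1 - norm (x * p))\<^sup>2"]])
     (use assms dpole_bound[OF order_refl assms(2,1)] in auto)

text \<open>The pole nearest to 0 is that of the first term, at 1 / p.\<close>

lemma dsum_holomorphic:
  assumes p: "p \<noteq> 0" "norm p < 1"
  shows "dsum p holomorphic_on ball 0 (1 / norm p)"
proof (rule holomorphic_on_ball_exhaust)
  fix r assume r: "r < 1 / norm p"
  then have r1: "r * norm p < 1" using p by (simp add: field_simps)
  have le: "norm (x * p) \<le> r * norm p" if "x \<in> ball 0 r" for x
    using that by (simp add: norm_mult mult_right_mono)
  show "dsum p holomorphic_on ball 0 r"
    unfolding dsum_def[abs_def]
  proof (rule holomorphic_on_suminf)
    show "summable (\<lambda>k. r / (1 - r * norm p)\<^sup>2 * norm p ^ Suc k)"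
      by (rule summable_const_power_Suc) (use p in auto)
    show "(\<lambda>x. dpole (x * p ^ Suc k)) holomorphic_on ball 0 r" for k
    proof -
      have "1 - x * p ^ Suc k \<noteq> 0" if "x \<in> ball 0 r" for x
        using power_Suc_norm_less[of p x k] le[OF that] r1 p by force
      then show ?thesis
        unfolding dpole_def by (intro holomorphic_intros) auto
    qed
    show "norm (dpole (x * p ^ Suc k)) \<le> r / (1 - r * norm p)\<^sup>2 * norm p ^ Suc k"
      if "x \<in> ball 0 r" for k x
    proof -
      have "norm (dpole (x * p ^ Suc k)) \<le> norm x / (1 - r * norm p)\<^sup>2 * norm p ^ Suc k"
        by (rule dpole_bound[OF le[OF that] r1 p(2)])
      also have "\<dots> \<le> r / (1 - r * norm p)\<^sup>2 * norm p ^ Suc k"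
        using that by (intro mult_right_mono divide_right_mono) auto
      finally show ?thesis .
    qed
  qed auto
qed

lemma dsum_rec:
  assumes "norm p < 1" "norm (x * p) < 1"
  shows "dsum p x = dpole (p * x) + dsum p (p * x)"
  using suminf_split_head[OF summable_dsum[OF assms]]
  by (simp add: dsum_def algebra_simps)

lemma dpole_inverse: "dpole (1 / v) = dpole v"
  by (cases "v = 0"; cases "v = 1") (auto simp: dpole_def field_simps power2_eq_square)

text \<open>By \<open>qprod_rec\<close> the factor 1 - px is absorbed into one product while 1 - 1/x
  leaves the other, and 1 - 1/x = -(1 - x)/x.\<close>

lemma theta_shift:
  assumes "p \<noteq> 0" "norm p < 1" "x \<noteq> 0"
  shows "theta p (p * x) = - theta p x / x"
proof -
  have "qprod p (1 / (p * x)) = (1 - 1 / x) * qprod p (1 / x)"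
    using qprod_rec[OF assms(2), of "1 / (p * x)"] assms by simp
  then have "theta p (p * x) = ((1 - p * x) * qprod p (p * x)) * ((1 - 1 / x) * qprod p (1 / x))"
    by (simp add: theta_def)
  also have "\<dots> = qprod p x * ((1 - 1 / x) * qprod p (1 / x))"
    by (simp only: qprod_rec[OF assms(2), of x, symmetric])
  finally show ?thesis using assms by (simp add: theta_def field_simps)
qed

lemma theta_inverse:
  assumes "x \<noteq> 0"
  shows "theta p (1 / x) = - theta p x / x"
  using assms by (simp add: theta_def field_simps)

lemma theta_1 [simp]: "theta p 1 = 0"
  by (simp add: theta_def)

text \<open>The two bounds on \<open>norm x\<close> are what \<open>dsum_rec\<close> needs at
  \<open>x\<close> and at \<open>1 / (p * x)\<close>; the shift then only moves one term of the
  two-sided sum.\<close>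

lemma wp_shift:
  assumes p: "p \<noteq> 0" "norm p < 1" and x: "1 < norm x" "norm x < 1 / norm p"
  shows "wp p (p * x) = wp p x"
proof -
  have x0: "x \<noteq> 0" using x by auto
  have "norm (x * p) < 1" using p x by (simp add: norm_mult field_simps)
  then have 1: "dsum p x = dpole (p * x) + dsum p (p * x)"
    by (rule dsum_rec[OF p(2)])
  have "norm (1 / (p * x) * p) < 1" using p x x0 by (simp add: norm_divide norm_mult field_simps)
  then have "dsum p (1 / (p * x)) = dpole (p * (1 / (p * x))) + dsum p (p * (1 / (p * x)))"
    by (rule dsum_rec[OF p(2)])
  then have 2: "dsum p (1 / (p * x)) = dpole x + dsum p (1 / x)"
    using p x0 by (simp add: dpole_inverse)
  show ?thesis by (simp add: wp_def 1 2)
qed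

section \<open>Differences of Weierstrass values as theta quotients\<close>

text \<open>The removable singularity theorem is applied twice; the second difference quotient has
  the wanted form because \<open>f1 a = deriv f a = 0\<close>.\<close>

lemma holomorphic_double_zero_factor:
  fixes f :: "complex \<Rightarrow> complex"
  assumes S: "open S" and f: "f holomorphic_on S" and "f a = 0" "deriv f a = 0"
  obtains g where "g holomorphic_on S" "\<And>z. z \<noteq> a \<Longrightarrow> g z = f z / (z - a)\<^sup>2"
proof -
  define f1 where "f1 = (\<lambda>z. if z = a then deriv f a else (f z - f a) / (z - a))"
  have f1: "f1 holomorphic_on S"
    unfolding f1_def by (rule pole_lemma_open[OF f S])
  have "(\<lambda>z. if z = a then deriv f1 a else (f1 z - f1 a) / (z - a)) holomorphic_on S"
    by (rule pole_lemma_open[OF f1 S])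
  then show ?thesis
    by (rule that) (use assms in \<open>auto simp: f1_def power2_eq_square\<close>)
qed

text \<open>By periodicity the maximum modulus is attained in the interior of the annulus.\<close>

lemma constant_on_annulus:
  fixes f :: "complex \<Rightarrow> complex"
  assumes p: "p \<noteq> 0" "norm p < 1"
    and holo: "f holomorphic_on {x. norm p < norm x \<and> norm x < 1 / norm p}"
    and shift: "\<And>x. 1 < norm x \<Longrightarrow> norm x < 1 / norm p \<Longrightarrow> f (p * x) = f x"
  shows "f constant_on {x. norm p < norm x \<and> norm x < 1 / norm p}"
proof -
  define A where "A = {x::complex. norm p < norm x \<and> norm x < 1 / norm p}"
  \<comment> \<open>\<open>K\<close> is the closed annulus from \<open>s\<close> to
    \<open>1 / s\<close>. As \<open>norm p = s * s\<close>, a point of \<open>A\<close> outside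
    \<open>K\<close> enters \<open>K\<close> after one multiplication or division by
    \<open>p\<close>, so the maximum over \<open>K\<close> is the maximum over
    \<open>A\<close>.\<close>
  define s where "s = sqrt (norm p)"
  define K where "K = cball (0::complex) (1 / s) - ball 0 s"
  have s: "0 < s" "s < 1" "norm p = s * s" using p by (auto simp: s_def)
  have ss: "s * s < s" using s by simp
  have "1 < 1 / s" "1 / s < 1 / (s * s)" using s by (auto simp: field_simps)
  then have KA: "K \<subseteq> A"
    unfolding K_def A_def s(3) using ss by (auto simp del: mult_less_cancel_right1 mult_less_cancel_left1
      mult_less_cancel_left2 mult_less_cancel_right2 simp: not_less)
  have A: "open A" "connected A"
    unfolding A_def using connected_annulus(1)[of "norm p" "0::complex" "1 / norm p"]
    by (auto intro!: open_Collect_conj open_Collect_less continuous_intros)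
  have "compact K" unfolding K_def by (intro compact_diff) auto
  moreover have "continuous_on K (\<lambda>x. norm (f x))"
    using holomorphic_on_imp_continuous_on[OF holo] KA
    by (auto simp: A_def intro!: continuous_intros intro: continuous_on_subset)
  moreover have "1 \<in> K" using s \<open>1 < 1 / s\<close> by (auto simp: K_def)
  ultimately obtain \<xi> where \<xi>: "\<xi> \<in> K" "\<And>x. x \<in> K \<Longrightarrow> norm (f x) \<le> norm (f \<xi>)"
    using continuous_attains_sup[of K "\<lambda>x. norm (f x)"] by blast
  have le: "norm (f x) \<le> norm (f \<xi>)" if x: "x \<in> A" for x
  proof -
    consider "norm x < s" | "norm x > 1 / s" | "x \<in> K" by (force simp: K_def)
    then show ?thesis
    proof cases
      case 1
      have "norm (x / p) = norm x / (s * s)" using s by (simp add: norm_divide)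
      moreover have "norm x / (s * s) < 1 / s" "1 < norm x / (s * s)"
        using 1 x s by (auto simp: A_def field_simps)
      ultimately have n: "norm (x / p) < 1 / s" "1 < norm (x / p)" by simp_all
      then have "x / p \<in> K" "norm (x / p) < 1 / norm p"
        unfolding K_def using s \<open>1 / s < 1 / (s * s)\<close> by (auto simp del: norm_divide)
      note this n(2)
      then show ?thesis using \<xi>(2)[of "x / p"] shift[of "x / p"] p by simp
    next
      case 2
      have "norm (p * x) = s * s * norm x" using s by (simp add: norm_mult)
      moreover have "s < s * s * norm x" "s * s * norm x < 1"
        using 2 x s by (auto simp: A_def field_simps)
      ultimately have "p * x \<in> K" using \<open>1 < 1 / s\<close> by (auto simp: K_def)
      moreover have "1 < norm x" using 2 \<open>1 < 1 / s\<close> by simp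
      ultimately show ?thesis using \<xi>(2)[of "p * x"] shift[of x] x by (simp add: A_def)
    qed (use \<xi> in auto)
  qed
  have "f constant_on A"
    by (rule maximum_modulus_principle[where U = A and \<xi> = \<xi>])
      (use holo KA \<xi>(1) A le in \<open>auto simp flip: A_def\<close>)
  then show ?thesis by (simp add: A_def)
qed

text \<open>
  As a function of \<open>x\<close>, the quotient \<open>\<theta>(xy)\<theta>(x/y)/\<theta>(x)\<^sup>2\<close> minus a multiple of \<open>\<wp>\<close> is invariant
  under \<open>x \<mapsto> px\<close>, and the symmetry \<open>x \<mapsto> 1/x\<close> excludes a simple pole at \<open>x = 1\<close>.
\<close>

lemma theta_wp:
  fixes p x y :: complex
  assumes p: "p \<noteq> 0" "norm p < 1"
    and x: "norm x = 1" "x \<noteq> 1" and y: "norm y = 1" "y \<noteq> 1"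
  shows "theta p (x * y) * theta p (x / y) * qprod p 1 ^ 4 =
    theta p y * theta p (1 / y) * theta p x ^ 2 * (wp p x - wp p y)"
proof -
  define A where "A = {x::complex. norm p < norm x \<and> norm x < 1 / norm p}"
  have p1: "norm p < 1" "1 < 1 / norm p" "0 < norm p" using p by auto
  have A0: "w \<noteq> 0" if "w \<in> A" for w using that p by (auto simp: A_def)
  have A1: "1 / w \<in> A" if "w \<in> A" for w
  proof -
    have "norm w > 0" using A0[OF that] by simp
    then show ?thesis using that p1 by (auto simp: A_def norm_divide field_simps)
  qed
  have A: "open A"
    unfolding A_def by (auto intro!: open_Collect_conj open_Collect_less continuous_intros)
  have one: "1 \<in> A" and xA: "x \<in> A" and yA: "y \<in> A" using p1 x y by (auto simp: A_def)
  have y0: "y \<noteq> 0" using y by auto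
  have qnz: "qprod p w \<noteq> 0" if "w \<in> A" for w
    using that p1 by (intro qprod_nonzero) (auto simp: A_def norm_mult field_simps)
  \<comment> \<open>\<open>g\<close> is \<open>theta p\<close> without the factor 1 - w. It has no
    zeros on \<open>A\<close>, so \<open>N\<close> is the theta quotient with its double pole at 1
    removed.\<close>
  define g where "g w = qprod p w * qprod p (1 / w)" for w
  define N where "N w = theta p (w * y) * theta p (w / y) / g w ^ 2" for w
  define c where "c = N 1"
  have gnz: "g w \<noteq> 0" if "w \<in> A" for w
    using qnz[OF that] qnz[OF A1[OF that]] by (simp add: g_def)
  have qcomp: "(\<lambda>w. qprod p (h w)) holomorphic_on A" if "h holomorphic_on A" for h
    using holomorphic_on_compose[OF that qprod_holomorphic[OF p(2)]] by (simp add: o_def)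
  have N: "N holomorphic_on A"
    unfolding N_def theta_def g_def
    by (intro holomorphic_intros qcomp) (use A0 y0 gnz in \<open>auto simp: g_def\<close>)
  have N_inv: "N (1 / w) = N w / w ^ 2" if "w \<in> A" for w
  proof -
    have w0: "w \<noteq> 0" by (rule A0[OF that])
    have "theta p (1 / w * y) = - theta p (w / y) / (w / y)"
      using theta_inverse[of "w / y" p] w0 y0 by simp
    moreover have "theta p (1 / w / y) = - theta p (w * y) / (w * y)"
      using theta_inverse[of "w * y" p] w0 y0 by simp
    moreover have "g (1 / w) = g w" by (simp add: g_def mult.commute)
    ultimately have "N (1 / w) = (- theta p (w / y) / (w / y)) * (- theta p (w * y) / (w * y)) / g w ^ 2"
      by (simp only: N_def)
    also have "\<dots> = N w / w ^ 2"
      using w0 y0 by (simp add: N_def power2_eq_square mult_ac)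
    finally show ?thesis .
  qed
  \<comment> \<open>Differentiating \<open>w^2 * N (1 / w) = N w\<close> at 1 gives 2 N(1) - N'(1) =
    N'(1).\<close>
  have "deriv N 1 = c"
  proof -
    have d: "(N has_field_derivative deriv N 1) (at 1)"
      using holomorphic_derivI[OF N A one] .
    have "((\<lambda>w. w ^ 2 * N (1 / w)) has_field_derivative 2 * N 1 - deriv N 1) (at 1)"
      using d by (auto intro!: derivative_eq_intros DERIV_chain'[where g = N and f = "\<lambda>w. 1 / w"])
    moreover have "w ^ 2 * N (1 / w) = N w" if "w \<in> A" for w
      using N_inv[OF that] A0[OF that] by simp
    ultimately have "(N has_field_derivative 2 * N 1 - deriv N 1) (at 1)"
      by (rule has_field_derivative_transform_within_open[OF _ A one])
    from DERIV_unique[OF this d] show ?thesis by (simp add: c_def)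
  qed
  \<comment> \<open>Hence \<open>N w - c * w\<close> has a double zero at 1. Since
    \<open>c * w / (w - 1)^2\<close> is \<open>c * dpole w\<close>, subtracting it removes the whole
    principal part.\<close>
  then have d0: "deriv (\<lambda>w. N w - c * w) 1 = 0"
    using holomorphic_derivI[OF N A one]
    by (intro DERIV_imp_deriv) (auto intro!: derivative_eq_intros)
  have Nc: "(\<lambda>w. N w - c * w) holomorphic_on A"
    by (intro holomorphic_intros N)
  obtain H where H: "H holomorphic_on A" "\<And>w. w \<noteq> 1 \<Longrightarrow> H w = (N w - c * w) / (w - 1) ^ 2"
    by (rule holomorphic_double_zero_factor[OF A Nc, of 1]) (use d0 in \<open>auto simp: c_def\<close>)
  define F where "F w = H w - c * (dsum p w + dsum p (1 / w))" for w
  have dcomp: "(\<lambda>w. dsum p (h w)) holomorphic_on A"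
    if "h holomorphic_on A" "\<And>w. w \<in> A \<Longrightarrow> h w \<in> A" for h
    using holomorphic_on_compose_gen[OF that(1) dsum_holomorphic[OF p]] that(2)
    by (force simp: o_def A_def)
  have Fholo: "F holomorphic_on A"
    unfolding F_def by (intro holomorphic_intros H dcomp) (use A0 A1 in auto)
  have F: "F w = theta p (w * y) * theta p (w / y) / theta p w ^ 2 - c * wp p w"
    if "w \<noteq> 1" for w
  proof -
    have "theta p w ^ 2 = g w ^ 2 * (w - 1) ^ 2"
      by (simp add: theta_def g_def power_mult_distrib power2_commute[of 1 w] mult_ac)
    then show ?thesis
      using that by (simp add: F_def H(2) N_def wp_def dpole_def power2_commute[of 1 w]
        diff_divide_distrib ring_distribs)
  qed
  have "F constant_on A"
    unfolding A_def
  proof (rule constant_on_annulus[OF p])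
    fix w :: complex assume w: "1 < norm w" "norm w < 1 / norm p"
    then have w0: "w \<noteq> 0" and w1: "w \<noteq> 1" by auto
    have "norm (p * w) < 1" using w p by (simp add: norm_mult field_simps)
    then have pw1: "p * w \<noteq> 1" by auto
    have "theta p (p * w * y) = - theta p (w * y) / (w * y)"
      using theta_shift[OF p, of "w * y"] w0 y0 by (simp add: mult.assoc)
    moreover have "theta p (p * w / y) = - theta p (w / y) / (w / y)"
      using theta_shift[OF p, of "w / y"] w0 y0 by simp
    moreover have "theta p (p * w) = - theta p w / w"
      by (rule theta_shift[OF p w0])
    ultimately have "F (p * w) = (- theta p (w * y) / (w * y)) * (- theta p (w / y) / (w / y)) /
        (- theta p w / w) ^ 2 - c * wp p w"
      by (simp only: F[OF pw1] wp_shift[OF p w])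
    also have "\<dots> = F w"
      using w0 y0 by (simp add: F[OF w1] power2_eq_square mult_ac)
    finally show "F (p * w) = F w" .
  qed (use Fholo in \<open>simp add: A_def\<close>)
  \<comment> \<open>At \<open>y\<close> the theta quotient vanishes, because
    \<open>theta p (y / y) = theta p 1 = 0\<close>; so \<open>F y = - c * wp p y\<close>.\<close>
  then have "F x = F y" using xA yA by (auto simp: constant_on_def)
  then have eq: "theta p (x * y) * theta p (x / y) / theta p x ^ 2 = c * (wp p x - wp p y)"
    using x y y0 by (simp add: F algebra_simps)
  have "theta p x \<noteq> 0" using x gnz[OF xA] by (simp add: theta_def g_def mult.assoc)
  then have "theta p (x * y) * theta p (x / y) = c * (wp p x - wp p y) * theta p x ^ 2"
    using eq by (simp add: nonzero_divide_eq_eq)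
  then have "theta p (x * y) * theta p (x / y) * qprod p 1 ^ 4 =
      c * qprod p 1 ^ 4 * theta p x ^ 2 * (wp p x - wp p y)"
    by (simp only: mult_ac)
  also have "c * qprod p 1 ^ 4 = theta p y * theta p (1 / y)"
    using qnz[OF one] by (simp add: c_def N_def g_def power4_eq_xxxx power2_eq_square)
  finally show ?thesis .
qed

section \<open>Values at roots of unity\<close>

lemma qprod_mult_minus:
  assumes p: "norm p < 1"
  shows "qprod p x * qprod p (- x) = qprod (p\<^sup>2) (x\<^sup>2)"
proof -
  have "qprod p x * qprod p (- x) = (\<Prod>j. (1 - x * p ^ Suc j) * (1 - (- x) * p ^ Suc j))"
    unfolding qprod_def by (rule prodinf_mult[OF convergent_prod_qprod[OF p] convergent_prod_qprod[OF p]])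
  also have "(\<lambda>j. (1 - x * p ^ Suc j) * (1 - (- x) * p ^ Suc j)) = (\<lambda>j. 1 - x\<^sup>2 * (p\<^sup>2) ^ Suc j)"
    by (rule ext) (simp only: power_commutes[symmetric] power_mult[symmetric] mult.commute[of 2]
        power_mult[of p _ 2] power2_eq_square ring_distribs, simp add: algebra_simps)
  finally show ?thesis by (simp add: qprod_def)
qed

lemma cube_root_facts:
  fixes w :: complex
  assumes "w\<^sup>2 + w + 1 = 0"
  shows "w \<noteq> 0" "1 / w = w\<^sup>2"
proof -
  have 3: "w ^ 3 = 1"
    using assms by algebra
  show "w \<noteq> 0" using assms by auto
  then show "1 / w = w\<^sup>2" using 3 by (simp add: field_simps power2_eq_square power3_eq_cube)
qed

text \<open>Factor by factor, (1 - v)(1 - wv)(1 - w^2 v) = 1 - v^3. This turns products at roots of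
  unity into Euler products in powers of \<open>p\<close>.\<close>

lemma qprod_mult_cube_roots:
  assumes p: "norm p < 1" and w: "w\<^sup>2 + w + 1 = 0"
  shows "qprod p x * qprod p (w * x) * qprod p (w\<^sup>2 * x) = qprod (p ^ 3) (x ^ 3)"
proof -
  note c = convergent_prod_qprod[OF p]
  have "qprod p x * qprod p (w * x) * qprod p (w\<^sup>2 * x) =
     (\<Prod>j. (1 - x * p ^ Suc j) * (1 - w * x * p ^ Suc j) * (1 - w\<^sup>2 * x * p ^ Suc j))"
    unfolding qprod_def by (simp only: prodinf_mult c convergent_prod_mult)
  also have "(\<lambda>j. (1 - x * p ^ Suc j) * (1 - w * x * p ^ Suc j) * (1 - w\<^sup>2 * x * p ^ Suc j)) =
      (\<lambda>j. 1 - x ^ 3 * (p ^ 3) ^ Suc j)"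
  proof
    fix j
    define v where "v = x * p ^ Suc j"
    have "(1 - v) * (1 - w * v) * (1 - w\<^sup>2 * v) = 1 - v ^ 3"
      using w by algebra
    moreover have "v ^ 3 = x ^ 3 * (p ^ 3) ^ Suc j"
      by (simp only: v_def power_mult_distrib power_mult[symmetric] mult.commute)
    ultimately show "(1 - x * p ^ Suc j) * (1 - w * x * p ^ Suc j) * (1 - w\<^sup>2 * x * p ^ Suc j) =
      1 - x ^ 3 * (p ^ 3) ^ Suc j"
      by (simp only: v_def mult.assoc)
  qed
  finally show ?thesis by (simp add: qprod_def)
qed

text \<open>In terms of the series of n v^n, adding the value at -v doubles the even terms, and 2 *
  (2m) v^(2m) = 4 m (v^2)^m.\<close>

lemma dpole_add_minus:
  assumes "norm v < 1"
  shows "dpole v + dpole (- v) = 4 * dpole (v\<^sup>2)"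
proof -
  have "v \<noteq> 1" "v \<noteq> -1" using assms by auto
  then have "1 - v \<noteq> 0" "1 + v \<noteq> 0" by (auto simp: add_eq_0_iff)
  moreover have "1 - v\<^sup>2 = (1 - v) * (1 + v)" by (simp add: algebra_simps power2_eq_square)
  ultimately show ?thesis
    unfolding dpole_def by (simp add: divide_simps) (simp add: algebra_simps power2_eq_square)
qed

text \<open>The cubic analogue: averaging over cube roots of unity keeps the exponents 3m, and 3 *
  (3m) = 9m.\<close>

lemma dpole_add_cube_roots:
  assumes v: "norm v < 1" and w: "w\<^sup>2 + w + 1 = 0" and "norm w = 1"
  shows "dpole v + dpole (w * v) + dpole (w\<^sup>2 * v) = 9 * dpole (v ^ 3)"
proof -
  have nz: "1 - v \<noteq> 0" "1 - w * v \<noteq> 0" "1 - w\<^sup>2 * v \<noteq> 0"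
  proof -
    have "1 - u \<noteq> 0" if "norm u < 1" for u :: complex using that by auto
    then show "1 - v \<noteq> 0" "1 - w * v \<noteq> 0" "1 - w\<^sup>2 * v \<noteq> 0"
      using assms by (simp_all add: norm_mult norm_power)
  qed
  have f: "1 - v ^ 3 = (1 - v) * (1 - w * v) * (1 - w\<^sup>2 * v)"
    using w by algebra
  have "v * ((1 - w * v) * (1 - w\<^sup>2 * v))\<^sup>2 + w * v * ((1 - v) * (1 - w\<^sup>2 * v))\<^sup>2 +
      w\<^sup>2 * v * ((1 - v) * (1 - w * v))\<^sup>2 = 9 * v ^ 3"
    using w by algebra
  moreover have "dpole v + dpole (w * v) + dpole (w\<^sup>2 * v) =
     (v * ((1 - w * v) * (1 - w\<^sup>2 * v))\<^sup>2 + w * v * ((1 - v) * (1 - w\<^sup>2 * v))\<^sup>2 +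
      w\<^sup>2 * v * ((1 - v) * (1 - w * v))\<^sup>2) / (1 - v ^ 3)\<^sup>2"
    unfolding f dpole_def using nz
    by (simp only: power_mult_distrib add_divide_distrib mult_divide_mult_cancel_left_if) 
      (simp add: power_mult_distrib)
  ultimately show ?thesis by (simp add: dpole_def)
qed

lemma dsum_add_minus:
  assumes p: "norm p < 1" and x: "norm x = 1"
  shows "dsum p x + dsum p (- x) = 4 * dsum (p\<^sup>2) (x\<^sup>2)"
proof -
  have small: "norm (x * p) < 1" "norm ((- x) * p) < 1" "norm (x\<^sup>2 * p\<^sup>2) < 1" "norm (p\<^sup>2) < 1"
    using p x by (auto simp: norm_mult norm_power power_less_one_iff)
  have "dsum p x + dsum p (- x) = (\<Sum>j. dpole (x * p ^ Suc j) + dpole ((- x) * p ^ Suc j))"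
    unfolding dsum_def by (intro suminf_add summable_dsum p small)
  also have "(\<lambda>j. dpole (x * p ^ Suc j) + dpole ((- x) * p ^ Suc j)) =
      (\<lambda>j. 4 * dpole (x\<^sup>2 * (p\<^sup>2) ^ Suc j))"
  proof
    fix j
    have "x\<^sup>2 * (p\<^sup>2) ^ Suc j = (x * p ^ Suc j)\<^sup>2"
      by (simp only: power_mult_distrib power_mult[symmetric] mult.commute)
    then show "dpole (x * p ^ Suc j) + dpole ((- x) * p ^ Suc j) = 4 * dpole (x\<^sup>2 * (p\<^sup>2) ^ Suc j)"
      using dpole_add_minus[OF power_Suc_norm_less[OF p small(1)], of j] by simp
  qed
  also have "(\<Sum>j. 4 * dpole (x\<^sup>2 * (p\<^sup>2) ^ Suc j)) = 4 * dsum (p\<^sup>2) (x\<^sup>2)"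
    unfolding dsum_def by (rule suminf_mult[OF summable_dsum[OF small(4,3)]])
  finally show ?thesis .
qed

lemma dsum_add_cube_roots:
  assumes p: "norm p < 1" and x: "norm x = 1" and w: "w\<^sup>2 + w + 1 = 0" "norm w = 1"
  shows "dsum p x + dsum p (w * x) + dsum p (w\<^sup>2 * x) = 9 * dsum (p ^ 3) (x ^ 3)"
proof -
  have small: "norm (x * p) < 1" "norm (w * x * p) < 1" "norm (w\<^sup>2 * x * p) < 1"
    "norm (x ^ 3 * p ^ 3) < 1" "norm (p ^ 3) < 1"
    using p x w by (auto simp: norm_mult norm_power power_less_one_iff)
  have "dsum p x + dsum p (w * x) + dsum p (w\<^sup>2 * x) =
    (\<Sum>j. dpole (x * p ^ Suc j) + dpole (w * x * p ^ Suc j) + dpole (w\<^sup>2 * x * p ^ Suc j))"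
    unfolding dsum_def by (simp only: suminf_add summable_add summable_dsum p small)
  also have "(\<lambda>j. dpole (x * p ^ Suc j) + dpole (w * x * p ^ Suc j) + dpole (w\<^sup>2 * x * p ^ Suc j)) =
      (\<lambda>j. 9 * dpole (x ^ 3 * (p ^ 3) ^ Suc j))"
  proof
    fix j
    have "x ^ 3 * (p ^ 3) ^ Suc j = (x * p ^ Suc j) ^ 3"
      by (simp only: power_mult_distrib power_mult[symmetric] mult.commute)
    then show "dpole (x * p ^ Suc j) + dpole (w * x * p ^ Suc j) + dpole (w\<^sup>2 * x * p ^ Suc j) =
      9 * dpole (x ^ 3 * (p ^ 3) ^ Suc j)"
      using dpole_add_cube_roots[OF power_Suc_norm_less[OF p small(1)] w, of j]
      by (simp only: mult.assoc)
  qed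
  also have "(\<Sum>j. 9 * dpole (x ^ 3 * (p ^ 3) ^ Suc j)) = 9 * dsum (p ^ 3) (x ^ 3)"
    unfolding dsum_def by (rule suminf_mult[OF summable_dsum[OF small(5,4)]])
  finally show ?thesis .
qed

section \<open>Lambert series and the Eisenstein series P\<close>

lemma dpole_sums:
  assumes "norm v < 1"
  shows "(\<lambda>n. of_nat n * v ^ n) sums dpole v"
proof -
  have "(\<lambda>n. v * (of_nat (Suc n) * v ^ n)) sums (v * (1 / (1 - v)\<^sup>2))"
    by (intro sums_mult geometric_deriv_sums assms)
  then have "(\<lambda>n. of_nat (Suc n) * v ^ Suc n) sums dpole v"
    by (simp add: dpole_def algebra_simps)
  then show ?thesis
    by (subst (asm) sums_Suc_iff) simp
qed

lemma one_minus_power_nonzero: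
  fixes p :: complex
  assumes "norm p < 1" "n > 0"
  shows "1 - p ^ n \<noteq> 0"
proof
  assume "1 - p ^ n = 0"
  then have "norm p ^ n = 1" by (metis eq_iff_diff_eq_0 norm_one norm_power)
  then show False using assms power_less_one_iff[of "norm p" n] by auto
qed

lemma summable_lambert:
  fixes p :: complex
  assumes p: "norm p < 1"
  shows "summable (\<lambda>n. of_nat n * p ^ n / (1 - p ^ n))"
proof (rule summable_comparison_test'[where N = 0])
  show "summable (\<lambda>n. (1 / (1 - norm p)) * (real n * norm p ^ n))"
  proof (rule summable_mult)
    have "summable (\<lambda>n. norm p * (of_nat (Suc n) * norm p ^ n))"
      using geometric_deriv_sums[of "norm p"] p by (intro summable_mult) (auto simp: sums_iff)
    then have "summable (\<lambda>n. real (Suc n) * norm p ^ Suc n)"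
      by (simp add: mult_ac)
    then show "summable (\<lambda>n. real n * norm p ^ n)"
      by (subst (asm) summable_Suc_iff)
  qed
  show "norm (of_nat n * p ^ n / (1 - p ^ n)) \<le> (1 / (1 - norm p)) * (real n * norm p ^ n)" for n
  proof (cases "n = 0")
    case False
    have "1 - norm p \<le> 1 - norm p ^ n"
      using power_decreasing[of 1 n "norm p"] False p by simp
    also have "\<dots> \<le> norm (1 - p ^ n)"
      by (metis norm_one norm_power norm_triangle_ineq2)
    finally have "real n * norm p ^ n / norm (1 - p ^ n) \<le> real n * norm p ^ n / (1 - norm p)"
      using p by (intro divide_left_mono mult_pos_pos) auto
    then show ?thesis by (simp add: norm_divide norm_mult norm_power)
  qed simp
qed

text \<open>
  Both sides, extended to functions of \<open>x\<close>, change by \<open>dpole (p x)\<close> under \<open>x \<mapsto> px\<close>; hence their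
  difference at 1 equals its limit along \<open>p\<^sup>k\<close>.
\<close>

lemma dsum_1_eq_lambert:
  assumes p: "p \<noteq> 0" "norm p < 1"
  shows "dsum p 1 = (\<Sum>n. of_nat n * p ^ n / (1 - p ^ n))"
proof -
  define c where "c n = of_nat n * p ^ n / (1 - p ^ n)" for n
  define V where "V x = (\<Sum>n. c n * x ^ n)" for x
  have sum1: "summable (\<lambda>n. c n * 1 ^ n)"
    using summable_lambert[OF p(2)] by (simp add: c_def)
  have sm: "summable (\<lambda>n. c n * x ^ n)" if "norm x < 1" for x
    by (rule powser_inside[OF sum1]) (use that in simp)
  have pk: "norm (p ^ k) \<le> 1" "norm (p ^ Suc k) < 1" for k
    using p by (auto simp: norm_power power_le_one power_Suc_less_one simp del: power_Suc)
  have sk: "summable (\<lambda>n. c n * (p ^ k) ^ n)" for k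
    using sm[OF pk(2)] sum1 by (cases k) auto
  have V: "V (p ^ k) = dpole (p ^ Suc k) + V (p ^ Suc k)" for k
  proof -
    have "V (p ^ k) - V (p ^ Suc k) = (\<Sum>n. c n * (p ^ k) ^ n - c n * (p ^ Suc k) ^ n)"
      unfolding V_def by (rule suminf_diff[OF sk sk])
    also have "(\<lambda>n. c n * (p ^ k) ^ n - c n * (p ^ Suc k) ^ n) = (\<lambda>n. of_nat n * (p ^ Suc k) ^ n)"
    proof
      fix n
      have "c n * (1 - p ^ n) = of_nat n * p ^ n"
        using one_minus_power_nonzero[OF p(2), of n] by (cases "n = 0") (auto simp: c_def)
      moreover have "(p ^ Suc k) ^ n = p ^ n * (p ^ k) ^ n" by (simp add: power_mult_distrib)
      moreover have "c n * (p ^ k) ^ n - c n * (p ^ n * (p ^ k) ^ n) = c n * (1 - p ^ n) * (p ^ k) ^ n"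
        by (simp add: algebra_simps)
      ultimately show "c n * (p ^ k) ^ n - c n * (p ^ Suc k) ^ n = of_nat n * (p ^ Suc k) ^ n"
        by (simp only: mult.assoc)
    qed
    also have "(\<Sum>n. of_nat n * (p ^ Suc k) ^ n) = dpole (p ^ Suc k)"
      using dpole_sums[OF pk(2)] by (simp only: sums_iff)
    finally show ?thesis by (simp add: algebra_simps)
  qed
  have D: "dsum p (p ^ k) = dpole (p ^ Suc k) + dsum p (p ^ Suc k)" for k
    using dsum_rec[OF p(2), of "p ^ k"] pk(2)[of k] by (simp add: mult.commute)
  have eq: "dsum p 1 - V 1 = dsum p (p ^ k) - V (p ^ k)" for k
    by (induction k) (use D V in auto)
  have lim: "(\<lambda>k. p ^ k) \<longlonglongrightarrow> 0" by (rule LIMSEQ_power_zero[OF p(2)])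
  have "isCont V 0"
    unfolding V_def by (rule isCont_powser[OF sum1]) simp
  moreover have "isCont (dsum p) 0"
    using holomorphic_on_imp_continuous_on[OF dsum_holomorphic[OF p]] p
    by (simp add: continuous_on_eq_continuous_at)
  ultimately have "(\<lambda>k. dsum p (p ^ k) - V (p ^ k)) \<longlonglongrightarrow> dsum p 0 - V 0"
    by (intro tendsto_diff isCont_tendsto_compose[OF _ lim])
  then have "dsum p 1 - V 1 = dsum p 0 - V 0"
    by (simp add: LIMSEQ_const_iff flip: eq)
  \<comment> \<open>\<open>c 0\<close> has zero numerator and zero denominator, and the convention
    for division makes it 0; \<open>dsum p 0\<close> is 0 as well.\<close>
  also have "V 0 = c 0" unfolding V_def by (rule powser_zero)
  finally show ?thesis by (simp add: V_def c_def dsum_def dpole_def)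
qed

lemma dsum_1_eq_ramanujan_P:
  assumes p: "p \<noteq> 0" "norm p < 1"
  shows "dsum p 1 = (1 - ramanujan_P p) / 24"
  using suminf_split_head[OF summable_lambert[OF p(2)]]
  by (simp add: dsum_1_eq_lambert[OF p] ramanujan_P_def)

section \<open>The Euler product and eta quotients of weight one\<close>

definition euler :: "complex \<Rightarrow> complex" where
  "euler q = qprod q 1"

lemma euler_nonzero: "norm q < 1 \<Longrightarrow> euler q \<noteq> 0"
  unfolding euler_def by (intro qprod_nonzero) auto

definition euler_pow :: "nat \<Rightarrow> complex \<Rightarrow> complex" where
  "euler_pow k q = euler (q ^ k)"

text \<open>The factor \<open>k\<close> makes \<open>P_pow k / 24\<close> the logarithmic
  derivative, with respect to log q, of the eta function at k times its argument.\<close>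

definition P_pow :: "nat \<Rightarrow> complex \<Rightarrow> complex" where
  "P_pow k q = of_nat k * ramanujan_P (q ^ k)"

text \<open>The four weight-one eta quotients of level 6, each vanishing at exactly one of the four cusps.\<close>

definition wt1a :: "complex \<Rightarrow> complex" where
  "wt1a q = euler_pow 1 q ^ 6 * euler_pow 6 q / (euler_pow 2 q ^ 3 * euler_pow 3 q ^ 2)"

definition wt1b :: "complex \<Rightarrow> complex" where
  "wt1b q = euler_pow 2 q ^ 6 * euler_pow 3 q / (euler_pow 1 q ^ 3 * euler_pow 6 q ^ 2)"

definition wt1c :: "complex \<Rightarrow> complex" where
  "wt1c q = euler_pow 3 q ^ 6 * euler_pow 2 q / (euler_pow 1 q ^ 2 * euler_pow 6 q ^ 3)"

text \<open>The factor \<open>q\<close> is the leading power of this eta quotient, (36 + 1 - 4 -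
  9)/24 = 1; for the other three quotients that exponent is 0.\<close>

definition wt1d :: "complex \<Rightarrow> complex" where
  "wt1d q = q * euler_pow 6 q ^ 6 * euler_pow 1 q / (euler_pow 2 q ^ 2 * euler_pow 3 q ^ 3)"

lemma power_norm_less_one:
  fixes q :: complex
  assumes "norm q < 1" "k > 0"
  shows "norm (q ^ k) < 1"
  using assms by (simp add: norm_power power_less_one_iff)

lemma euler_pow_nonzero:
  assumes "norm q < 1" "k > 0"
  shows "euler_pow k q \<noteq> 0"
  unfolding euler_pow_def by (intro euler_nonzero power_norm_less_one assms)

lemma cube_root_exists:
  obtains w :: complex where "w\<^sup>2 + w + 1 = 0" "norm w = 1"
proof
  show "(Complex (-1/2) (sqrt 3 / 2))\<^sup>2 + Complex (-1/2) (sqrt 3 / 2) + 1 = 0"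
    by (simp add: complex_eq_iff power2_eq_square)
  show "norm (Complex (-1/2) (sqrt 3 / 2)) = 1"
    by (simp add: complex_norm power2_eq_square)
qed

text \<open>At -1, w and -w the theta values are quotients of Euler products, and the values of
  \<open>wp\<close> are combinations of the \<open>P_pow\<close>. Three instances of
  \<open>theta_wp\<close> equate the two descriptions.\<close>

lemma
  assumes q: "q \<noteq> 0" "norm q < 1"
  shows wt1a_square: "wt1a q ^ 2 = (P_pow 1 q - 4 * P_pow 2 q + 3 * P_pow 3 q) / 2"
    and wt1a_wt1b: "wt1a q * wt1b q = (P_pow 1 q - P_pow 2 q - 3 * P_pow 3 q + 3 * P_pow 6 q) / 8"
    and wt1a_wt1c: "wt1a q * wt1c q = (P_pow 1 q - 2 * P_pow 2 q - P_pow 3 q + 2 * P_pow 6 q) / 6"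
proof -
  obtain w :: complex where w: "w\<^sup>2 + w + 1 = 0" and nw: "norm w = 1"
    by (rule cube_root_exists)
  note wf = cube_root_facts[OF w]
  have w1: "w \<noteq> 1" "w \<noteq> - 1"
    using w by (auto simp: power2_eq_square)
  have q3: "norm (q ^ 3) < 1" using power_norm_less_one[OF q(2)] by simp
  have q32: "(q ^ 3)\<^sup>2 = q ^ 6" by (simp flip: power_mult)
  define A where "A = qprod q (- 1)"
  define B where "B = qprod q w * qprod q (w\<^sup>2)"
  define C where "C = qprod q (- w) * qprod q (- (w\<^sup>2))"
  define e1 e2 e3 e6 where "e1 = euler_pow 1 q" and "e2 = euler_pow 2 q"
    and "e3 = euler_pow 3 q" and "e6 = euler_pow 6 q"
  have enz: "e1 \<noteq> 0" "e2 \<noteq> 0" "e3 \<noteq> 0" "e6 \<noteq> 0"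
    unfolding e1_def e2_def e3_def e6_def by (intro euler_pow_nonzero q(2); simp)+
  have A: "A = e2 / e1"
    using qprod_mult_minus[OF q(2), of 1] enz by (simp add: A_def e1_def e2_def euler_pow_def euler_def field_simps)
  have B: "B = e3 / e1"
    using qprod_mult_cube_roots[OF q(2) w, of 1] enz
    by (simp add: B_def e1_def e3_def euler_pow_def euler_def field_simps)
  have "qprod (q ^ 3) (- 1) = e6 / e3"
    using qprod_mult_minus[OF q3, of 1] enz
    by (simp add: q32 e3_def e6_def euler_pow_def euler_def field_simps)
  \<comment> \<open>The numbers -1, -w, -w^2 are the cube roots of -1, so their product is
    \<open>qprod (q ^ 3) (- 1)\<close>.\<close>
  then have "A * C = e6 / e3"
    using qprod_mult_cube_roots[OF q(2) w, of "- 1"] by (simp add: A_def C_def mult.assoc)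
  then have C: "C = e6 * e1 / (e3 * e2)"
    using enz by (simp add: A field_simps)
  have inv: "1 / w = w\<^sup>2" "1 / - w = - (w\<^sup>2)" "- 1 / w = - (w\<^sup>2)" "- 1 / - w = w\<^sup>2" "w / - w = - 1"
    "w * - w = - (w\<^sup>2)"
    using wf(1) unfolding wf(2)[symmetric] by (simp_all add: wf(2) power2_eq_square)
  have th1: "theta q (- 1) = 2 * A ^ 2"
    by (simp add: theta_def A_def power2_eq_square)
  have thw: "theta q w = (1 - w) * B"
    by (simp add: theta_def B_def inv(1))
  have thw': "theta q (w\<^sup>2) = - ((1 - w) * B / w)"
    using theta_inverse[of w q] wf(1) by (simp add: thw inv(1))
  have thmw: "theta q (- w) = (1 + w) * C"
    by (simp only: theta_def C_def inv(2)) simp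
  have thmw': "theta q (- (w\<^sup>2)) = (1 + w) * C / w"
    using theta_inverse[of "- w" q, unfolded inv(2)] wf(1) by (simp add: thmw)
  define L where "L k = (1 - ramanujan_P (q ^ k)) / 24" for k
  have L: "dsum (q ^ k) 1 = L k" if "k > 0" for k
    unfolding L_def using q power_norm_less_one[OF q(2) that] by (intro dsum_1_eq_ramanujan_P) auto
  have d1: "dsum q (- 1) = 4 * L 2 - L 1"
    using dsum_add_minus[OF q(2), of 1] L[of 1] L[of 2] by (simp add: algebra_simps)
  have dw: "dsum q w + dsum q (w\<^sup>2) = 9 * L 3 - L 1"
    using dsum_add_cube_roots[OF q(2) _ w nw, of 1] L[of 1] L[of 3]
    by (simp add: algebra_simps)
  have d31: "dsum (q ^ 3) (- 1) = 4 * L 6 - L 3"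
    using dsum_add_minus[OF q3, of 1] L[of 3] L[of 6] by (simp add: algebra_simps q32)
  have dmw: "dsum q (- w) + dsum q (- (w\<^sup>2)) = 9 * (4 * L 6 - L 3) - (4 * L 2 - L 1)"
    using dsum_add_cube_roots[OF q(2) _ w nw, of "- 1"] d31 d1
    by (simp add: algebra_simps)
  have sq: "(1 - w)\<^sup>2 = - 3 * w" "(1 + w)\<^sup>2 = w" "(1 + w) * (1 - w)\<^sup>2 = 3"
    using w by algebra+
  \<comment> \<open>The constants are values of \<open>dpole\<close>: -1/4 at -1, w/(1 - w)^2 = -1/3
    at w, and -w/(1 + w)^2 = -1 at -w.\<close>
  have wp1: "wp q (- 1) = - 1 / 4 + 2 * (4 * L 2 - L 1)"
    by (simp add: wp_def d1 dpole_def)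
  have wpw: "wp q w = - 1 / 3 + (9 * L 3 - L 1)"
    using wf(1) by (simp only: wp_def inv add.assoc dw) (simp add: dpole_def sq)
  have wpmw: "wp q (- w) = - 1 + (9 * (4 * L 6 - L 3) - (4 * L 2 - L 1))"
    using wf(1) by (simp only: wp_def inv add.assoc dmw) (simp add: dpole_def sq)
  note th = theta_wp[OF q]
  have i1: "C\<^sup>2 * e1 ^ 4 = 12 * A ^ 4 * B\<^sup>2 * (wp q (- 1) - wp q w)"
  proof -
    define u where "u = wp q (- 1) - wp q w"
    have "theta q (- w) * theta q (- (w\<^sup>2)) * qprod q 1 ^ 4 =
      theta q w * theta q (w\<^sup>2) * theta q (- 1) ^ 2 * u"
      using th[of "- 1" w, unfolded inv] nw w1 by (simp add: u_def)
    then have "(1 + w)\<^sup>2 / w * (C\<^sup>2 * e1 ^ 4) = - ((1 - w)\<^sup>2 / w) * (4 * A ^ 4 * B\<^sup>2 * u)"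
      unfolding thw thw' thmw thmw' th1 e1_def euler_pow_def euler_def
      by (simp add: power2_eq_square power4_eq_xxxx mult_ac)
    then show ?thesis using wf(1) by (simp add: sq mult.assoc flip: u_def)
  qed
  have i2: "2 * A\<^sup>2 * e1 ^ 4 = 3 * C * B\<^sup>2 * (wp q w - wp q (- w))"
  proof -
    define u where "u = wp q w - wp q (- w)"
    have "theta q (- (w\<^sup>2)) * theta q (- 1) * qprod q 1 ^ 4 =
      theta q (- w) * theta q (- (w\<^sup>2)) * theta q w ^ 2 * u"
      using th[of w "- w", unfolded inv] nw w1 wf(1) by (simp add: u_def minus_equation_iff)
    \<comment> \<open>The common factor on both sides is \<open>theta q (- (w^2))\<close>; it is
      nonzero and is cancelled.\<close>
    then have "((1 + w) / w * C) * (2 * A\<^sup>2 * e1 ^ 4) =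
      ((1 + w) / w * C) * (((1 + w) * (1 - w)\<^sup>2) * (C * B\<^sup>2 * u))"
      unfolding thw thmw thmw' th1 e1_def euler_pow_def euler_def
      by (simp add: power_mult_distrib mult_ac)
    moreover have "(1 + w) / w * C \<noteq> 0"
      using wf(1) w1 enz by (simp add: C add_eq_0_iff minus_equation_iff)
    ultimately have "2 * A\<^sup>2 * e1 ^ 4 = ((1 + w) * (1 - w)\<^sup>2) * (C * B\<^sup>2 * u)"
      using mult_left_cancel by blast
    then show ?thesis unfolding sq(3) by (simp add: mult.assoc flip: u_def)
  qed
  have i3: "3 * B\<^sup>2 * e1 ^ 4 = 4 * C\<^sup>2 * A ^ 4 * (wp q (- 1) - wp q (- w))"
  proof -
    define u where "u = wp q (- 1) - wp q (- w)"
    have "theta q w * theta q (w\<^sup>2) * qprod q 1 ^ 4 =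
      theta q (- w) * theta q (- (w\<^sup>2)) * theta q (- 1) ^ 2 * u"
      using th[of "- 1" "- w", unfolded inv] nw w1 by (simp add: u_def minus_equation_iff)
    then have "- ((1 - w)\<^sup>2 / w) * (B\<^sup>2 * e1 ^ 4) = (1 + w)\<^sup>2 / w * (4 * C\<^sup>2 * A ^ 4 * u)"
      unfolding thw thw' thmw thmw' th1 e1_def euler_pow_def euler_def
      by (simp add: power2_eq_square power4_eq_xxxx mult_ac)
    then show ?thesis using wf(1) by (simp add: sq mult.assoc flip: u_def)
  qed
  have abc: "wt1a q = e1 ^ 6 * e6 / (e2 ^ 3 * e3 ^ 2)" "wt1b q = e2 ^ 6 * e3 / (e1 ^ 3 * e6 ^ 2)"
    "wt1c q = e3 ^ 6 * e2 / (e1 ^ 2 * e6 ^ 3)"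
    by (simp_all add: wt1a_def wt1b_def wt1c_def e1_def e2_def e3_def e6_def)
  have "wt1a q ^ 2 = C\<^sup>2 * e1 ^ 4 / (A ^ 4 * B\<^sup>2)"
    using enz by (simp add: abc A B C field_simps)
  also have "\<dots> = 12 * (wp q (- 1) - wp q w)"
    using enz by (simp add: i1 A B)
  also have "\<dots> = (P_pow 1 q - 4 * P_pow 2 q + 3 * P_pow 3 q) / 2"
    by (simp add: wp1 wpw L_def P_pow_def field_simps)
  finally show "wt1a q ^ 2 = (P_pow 1 q - 4 * P_pow 2 q + 3 * P_pow 3 q) / 2" .
  have "wt1a q * wt1b q = 1 / 2 * (2 * A\<^sup>2 * e1 ^ 4) / (C * B\<^sup>2)"
    using enz by (simp add: abc A B C divide_simps) (simp add: eval_nat_numeral mult_ac)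
  also have "\<dots> = 3 / 2 * (wp q w - wp q (- w))"
    using enz by (simp only: i2) (simp add: B C)
  also have "\<dots> = (P_pow 1 q - P_pow 2 q - 3 * P_pow 3 q + 3 * P_pow 6 q) / 8"
    by (simp add: wpw wpmw L_def P_pow_def field_simps)
  finally show "wt1a q * wt1b q = (P_pow 1 q - P_pow 2 q - 3 * P_pow 3 q + 3 * P_pow 6 q) / 8" .
  have "wt1a q * wt1c q = 1 / 3 * (3 * B\<^sup>2 * e1 ^ 4) / (C\<^sup>2 * A ^ 4)"
    using enz by (simp add: abc A B C divide_simps) (simp add: eval_nat_numeral mult_ac)
  also have "\<dots> = 4 / 3 * (wp q (- 1) - wp q (- w))"
    using enz by (simp only: i3) (simp add: A C)
  also have "\<dots> = (P_pow 1 q - 2 * P_pow 2 q - P_pow 3 q + 2 * P_pow 6 q) / 6"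
    by (simp add: wp1 wpmw L_def P_pow_def field_simps)
  finally show "wt1a q * wt1c q = (P_pow 1 q - 2 * P_pow 2 q - P_pow 3 q + 2 * P_pow 6 q) / 6" .
qed

section \<open>Derivative of the Euler product\<close>

text \<open>A disc of radius \<open>r\<close> strictly between \<open>norm q\<close> and 1 supplies
  the geometric majorant. The series is not multiplied by \<open>q\<close>, so that it also
  determines the derivative at 0.\<close>

lemma
  assumes q: "norm q < 1"
  shows euler_field_differentiable: "euler field_differentiable at q"
    and euler_logderiv_sums:
      "(\<lambda>j. - (of_nat (Suc j) * q ^ j) / (1 - q ^ Suc j)) sums (deriv euler q / euler q)"
proof -
  have e: "euler = (\<lambda>q. \<Prod>j. 1 - q ^ Suc j)" by (simp add: euler_def[abs_def] qprod_def)
  obtain r where r: "norm q < r" "r < 1" using dense[OF q] by blast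
  have r0: "0 \<le> r" using r(1) norm_ge_zero[of q] by linarith
  have A: "open (ball (0::complex) r)" by simp
  have M: "summable (\<lambda>k. r ^ Suc k)"
    using summable_const_power_Suc[of r 1] r0 r by simp
  have holo: "(\<lambda>q. 1 - q ^ Suc k) holomorphic_on ball 0 r" for k
    by (intro holomorphic_intros)
  have bound: "norm (1 - x ^ Suc k - 1) \<le> r ^ Suc k" if "x \<in> ball 0 r" for x :: complex and k
    using power_mono[of "norm x" r "Suc k"] that by (simp add: norm_mult norm_power)
  have qr: "q \<in> ball 0 r" using r by simp
  have nz: "1 - q ^ Suc k \<noteq> 0" for k by (rule one_minus_power_nonzero[OF q]) simp
  have "euler holomorphic_on ball 0 r"
    unfolding e by (rule holomorphic_on_prodinf[OF A holo M bound])
  then show "euler field_differentiable at q"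
    using qr by (intro holomorphic_on_imp_differentiable_at[of _ "ball 0 r"]) auto
  have "(\<lambda>k. deriv (\<lambda>q. 1 - q ^ Suc k) q / (1 - q ^ Suc k)) sums (deriv euler q / euler q)"
    unfolding e by (rule logderiv_prodinf_sums[OF A holo M bound qr nz])
  moreover have "deriv (\<lambda>q. 1 - q ^ Suc k) q = - (of_nat (Suc k) * q ^ k)" for k
    by (rule DERIV_imp_deriv) (auto intro!: derivative_eq_intros simp del: power_Suc)
  ultimately show
    "(\<lambda>j. - (of_nat (Suc j) * q ^ j) / (1 - q ^ Suc j)) sums (deriv euler q / euler q)"
    by simp
qed

lemma euler_logderiv:
  assumes q: "norm q < 1"
  shows "q * deriv euler q = euler q * (ramanujan_P q - 1) / 24"
proof -
  have "(\<lambda>j. - q * (- (of_nat (Suc j) * q ^ j) / (1 - q ^ Suc j))) sums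
      (- q * (deriv euler q / euler q))"
    by (intro sums_mult euler_logderiv_sums q)
  then have "(\<lambda>j. of_nat (Suc j) * q ^ Suc j / (1 - q ^ Suc j)) sums
      (- q * (deriv euler q / euler q))"
    by (simp add: mult_ac)
  then have "ramanujan_P q = 1 + 24 * (q * (deriv euler q / euler q))"
    unfolding ramanujan_P_def by (simp add: sums_iff)
  then show ?thesis
    using euler_nonzero[OF q] by (simp add: field_simps)
qed

lemma euler_deriv_0: "deriv euler 0 = - 1"
proof -
  have "(\<lambda>j. - (of_nat (Suc j) * 0 ^ j) / (1 - 0 ^ Suc j)) sums (deriv euler 0 / euler 0)"
    by (rule euler_logderiv_sums) simp
  \<comment> \<open>Only the term \<open>j = 0\<close> survives, with
    \<open>0 ^ 0 = 1\<close>.\<close>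
  moreover have "(\<lambda>j. - (of_nat (Suc j) * 0 ^ j) / (1 - 0 ^ Suc j) :: complex) =
      (\<lambda>j. if j = 0 then - 1 else 0)"
    by auto
  ultimately have "deriv euler 0 / euler 0 = - 1"
    using sums_single[of 0 "\<lambda>_. - 1 :: complex"] sums_unique2 by auto
  moreover have "euler 0 = 1" by (simp add: euler_def qprod_def)
  ultimately show ?thesis by simp
qed

section \<open>Logarithmic derivatives\<close>

text \<open>Multiplying out by \<open>f q\<close> keeps the notion meaningful at zeros of
  \<open>f\<close>, and the witness \<open>D\<close> carries differentiability along. The derivation
  is q d/dq.\<close>

definition logd :: "(complex \<Rightarrow> complex) \<Rightarrow> complex \<Rightarrow> complex \<Rightarrow> bool" where
  "logd f q L \<longleftrightarrow> (\<exists>D. (f has_field_derivative D) (at q) \<and> q * D = f q * L)"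

lemma logd_eq:
  assumes "logd f q L" "(f has_field_derivative D) (at q)"
  shows "q * D = f q * L"
  using assms DERIV_unique unfolding logd_def by blast

lemma logd_mult: "logd f q L \<Longrightarrow> logd g q M \<Longrightarrow> logd (\<lambda>q. f q * g q) q (L + M)"
  unfolding logd_def
proof safe
  fix D E assume *: "(f has_field_derivative D) (at q)" "q * D = f q * L"
    "(g has_field_derivative E) (at q)" "q * E = g q * M"
  show "\<exists>D. ((\<lambda>q. f q * g q) has_field_derivative D) (at q) \<and> q * D = f q * g q * (L + M)"
  proof (intro exI conjI)
    show "((\<lambda>q. f q * g q) has_field_derivative D * g q + E * f q) (at q)"
      by (rule DERIV_mult[OF *(1,3)])
    show "q * (D * g q + E * f q) = f q * g q * (L + M)"
      using *(2,4) by algebra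
  qed
qed

lemma logd_inverse:
  assumes "logd f q L" "f q \<noteq> 0"
  shows "logd (\<lambda>q. inverse (f q)) q (- L)"
proof -
  obtain D where D: "(f has_field_derivative D) (at q)" "q * D = f q * L"
    using assms unfolding logd_def by blast
  have "((\<lambda>q. inverse (f q)) has_field_derivative - (inverse (f q) * D * inverse (f q))) (at q)"
    by (rule DERIV_inverse'[OF D(1) assms(2)])
  moreover have "q * - (inverse (f q) * D * inverse (f q)) = - (q * D) * inverse (f q) * inverse (f q)"
    by (simp add: mult_ac)
  moreover have "\<dots> = inverse (f q) * - L"
    using assms(2) by (simp add: D(2))
  ultimately show ?thesis unfolding logd_def by metis
qed

lemma logd_divide:
  assumes "logd f q L" "logd g q M" "g q \<noteq> 0"
  shows "logd (\<lambda>q. f q / g q) q (L - M)"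
  using logd_mult[OF assms(1) logd_inverse[OF assms(2,3)]] by (simp add: divide_inverse)

lemma logd_power: "logd f q L \<Longrightarrow> logd (\<lambda>q. f q ^ n) q (of_nat n * L)"
proof (induction n)
  case 0
  then show ?case by (auto simp: logd_def intro!: exI[of _ 0])
next
  case (Suc n)
  from logd_mult[OF Suc(2) Suc(1)[OF Suc(2)]] show ?case by (simp add: algebra_simps)
qed

lemma logd_ident: "logd (\<lambda>q. q) q 1"
  by (auto simp: logd_def intro!: exI[of _ 1])

lemma euler_pow_has_field_derivative:
  assumes "norm q < 1" "k > 0"
  shows "(euler_pow k has_field_derivative deriv euler (q ^ k) * (of_nat k * q ^ (k - 1))) (at q)"
proof -
  have "(euler has_field_derivative deriv euler (q ^ k)) (at (q ^ k))"
    using euler_field_differentiable[OF power_norm_less_one[OF assms]]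
    by (simp add: DERIV_deriv_iff_field_differentiable)
  moreover have "((\<lambda>q. q ^ k) has_field_derivative of_nat k * q ^ (k - 1)) (at q)"
    by (auto intro!: derivative_eq_intros)
  ultimately show ?thesis
    unfolding euler_pow_def[abs_def] by (rule DERIV_chain2)
qed

lemma logd_euler_pow:
  assumes "norm q < 1" "k > 0"
  shows "logd (euler_pow k) q ((P_pow k q - of_nat k) / 24)"
  unfolding logd_def
proof (intro exI conjI)
  show "(euler_pow k has_field_derivative deriv euler (q ^ k) * (of_nat k * q ^ (k - 1))) (at q)"
    by (rule euler_pow_has_field_derivative[OF assms])
  have "q * (deriv euler (q ^ k) * (of_nat k * q ^ (k - 1))) =
      of_nat k * (q ^ k * deriv euler (q ^ k))"
    using assms(2) by (simp add: power_eq_if mult_ac)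
  also have "\<dots> = euler_pow k q * ((P_pow k q - of_nat k) / 24)"
    unfolding euler_logderiv[OF power_norm_less_one[OF assms]]
    by (simp add: euler_pow_def P_pow_def algebra_simps)
  finally show "q * (deriv euler (q ^ k) * (of_nat k * q ^ (k - 1))) =
      euler_pow k q * ((P_pow k q - of_nat k) / 24)" .
qed

lemma euler_pow_holomorphic:
  assumes "k > 0"
  shows "euler_pow k holomorphic_on ball 0 1"
proof (subst holomorphic_on_open)
  show "\<forall>q\<in>ball 0 1. \<exists>D. (euler_pow k has_field_derivative D) (at q)"
    using euler_pow_has_field_derivative[OF _ assms] by (meson mem_ball_0)
qed simp

text \<open>Holomorphy is read off from the logarithmic derivative of \<open>euler_pow k\<close>
  instead of from the Lambert series.\<close>

lemma P_pow_holomorphic: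
  assumes "k > 0"
  shows "P_pow k holomorphic_on ball 0 1"
proof -
  have "(\<lambda>q. of_nat k + 24 * (q * deriv (euler_pow k) q / euler_pow k q)) holomorphic_on ball 0 1"
    using euler_pow_nonzero[OF _ assms]
    by (intro holomorphic_intros euler_pow_holomorphic assms holomorphic_deriv) auto
  moreover have "of_nat k + 24 * (q * deriv (euler_pow k) q / euler_pow k q) = P_pow k q"
    if "norm q < 1" for q
    using logd_eq[OF logd_euler_pow[OF that assms] euler_pow_has_field_derivative[OF that assms]]
      DERIV_imp_deriv[OF euler_pow_has_field_derivative[OF that assms]] euler_pow_nonzero[OF that assms]
    by (simp add: field_simps)
  ultimately show ?thesis by (rule holomorphic_transform) simp
qed

lemma wt1_nonzero:
  assumes "norm q < 1"
  shows "wt1a q \<noteq> 0" "wt1b q \<noteq> 0" "wt1c q \<noteq> 0"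
  using euler_pow_nonzero[OF assms] by (simp_all add: wt1a_def wt1b_def wt1c_def)

lemma wt1_holomorphic:
  "wt1a holomorphic_on ball 0 1" "wt1b holomorphic_on ball 0 1"
  unfolding wt1a_def[abs_def] wt1b_def[abs_def]
  by (intro holomorphic_intros euler_pow_holomorphic; simp add: euler_pow_nonzero)+

text \<open>The exponents of each eta quotient become the coefficients of the \<open>P_pow\<close>.
  The constants \<open>of_nat k\<close> cancel for a, b, c, and for d they cancel against the 1
  coming from the factor \<open>q\<close>.\<close>

lemma
  assumes q: "norm q < 1"
  shows logd_wt1a: "logd wt1a q ((6 * P_pow 1 q + P_pow 6 q - 3 * P_pow 2 q - 2 * P_pow 3 q) / 24)"
    and logd_wt1b: "logd wt1b q ((6 * P_pow 2 q + P_pow 3 q - 3 * P_pow 1 q - 2 * P_pow 6 q) / 24)"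
    and logd_wt1c: "logd wt1c q ((6 * P_pow 3 q + P_pow 2 q - 2 * P_pow 1 q - 3 * P_pow 6 q) / 24)"
    and logd_wt1d: "logd wt1d q ((6 * P_pow 6 q + P_pow 1 q - 2 * P_pow 2 q - 3 * P_pow 3 q) / 24)"
proof -
  note nz = euler_pow_nonzero[OF q]
  define l where "l k = (P_pow k q - of_nat k) / 24" for k
  have l: "logd (euler_pow k) q (l k)" if "k > 0" for k
    unfolding l_def by (rule logd_euler_pow[OF q that])
  note l = l[of 1, simplified] l[of 2, simplified] l[of 3, simplified] l[of 6, simplified]
  have "logd wt1a q (of_nat 6 * l 1 + l 6 - (of_nat 3 * l 2 + of_nat 2 * l 3))"
    unfolding wt1a_def[abs_def] One_nat_def
    by (intro logd_divide logd_mult logd_power l) (use nz in auto)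
  then show "logd wt1a q ((6 * P_pow 1 q + P_pow 6 q - 3 * P_pow 2 q - 2 * P_pow 3 q) / 24)"
    by (rule back_subst[where P = "logd wt1a q"]) (simp add: l_def field_simps)
  have "logd wt1b q (of_nat 6 * l 2 + l 3 - (of_nat 3 * l 1 + of_nat 2 * l 6))"
    unfolding wt1b_def[abs_def] One_nat_def
    by (intro logd_divide logd_mult logd_power l) (use nz in auto)
  then show "logd wt1b q ((6 * P_pow 2 q + P_pow 3 q - 3 * P_pow 1 q - 2 * P_pow 6 q) / 24)"
    by (rule back_subst[where P = "logd wt1b q"]) (simp add: l_def field_simps)
  have "logd wt1c q (of_nat 6 * l 3 + l 2 - (of_nat 2 * l 1 + of_nat 3 * l 6))"
    unfolding wt1c_def[abs_def] One_nat_def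
    by (intro logd_divide logd_mult logd_power l) (use nz in auto)
  then show "logd wt1c q ((6 * P_pow 3 q + P_pow 2 q - 2 * P_pow 1 q - 3 * P_pow 6 q) / 24)"
    by (rule back_subst[where P = "logd wt1c q"]) (simp add: l_def field_simps)
  have "logd wt1d q (1 + of_nat 6 * l 6 + l 1 - (of_nat 2 * l 2 + of_nat 3 * l 3))"
    unfolding wt1d_def[abs_def] One_nat_def
    by (intro logd_divide logd_mult logd_power logd_ident l) (use nz in auto)
  then show "logd wt1d q ((6 * P_pow 6 q + P_pow 1 q - 2 * P_pow 2 q - 3 * P_pow 3 q) / 24)"
    by (rule back_subst[where P = "logd wt1d q"]) (simp add: l_def field_simps)
qed

section \<open>Linear relations among the weight-one eta quotients\<close>

text \<open>After multiplication by \<open>wt1a q\<close> both sides are known combinations of the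
  \<open>P_pow\<close>; the nonzero factor is then cancelled.\<close>

lemma wt1c_eq:
  assumes q: "q \<noteq> 0" "norm q < 1"
  shows "wt1c q = (wt1a q + 8 * wt1b q) / 9"
proof -
  have "wt1a q * ((wt1a q + 8 * wt1b q) / 9) = (wt1a q ^ 2 + 8 * (wt1a q * wt1b q)) / 9"
    by (simp add: algebra_simps power2_eq_square)
  also have "\<dots> = wt1a q * wt1c q"
    unfolding wt1a_square[OF q] wt1a_wt1b[OF q] wt1a_wt1c[OF q] by (simp add: field_simps)
  finally show ?thesis using wt1_nonzero[OF q(2)] by simp
qed

text \<open>Differentiate the relation \<open>9c/b = a/b + 8\<close>.\<close>

lemma wt1c_diff:
  assumes q: "q \<noteq> 0" "norm q < 1"
  shows "wt1c q * (wt1b q - wt1a q) = (- 9 * P_pow 1 q + 9 * P_pow 2 q + 3 * P_pow 3 q - 3 * P_pow 6 q) / 24"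
proof -
  note q' = wt1_nonzero[OF q(2)]
  define X where "X = (9 * P_pow 1 q - 9 * P_pow 2 q - 3 * P_pow 3 q + 3 * P_pow 6 q) / 24"
  define Y where "Y = (P_pow 1 q - 5 * P_pow 2 q + 5 * P_pow 3 q - P_pow 6 q) / 24"
  have t: "logd (\<lambda>q. wt1a q / wt1b q) q X"
    using logd_divide[OF logd_wt1a[OF q(2)] logd_wt1b[OF q(2)] q'(2)]
    by (rule back_subst[where P = "logd _ q"]) (simp add: X_def field_simps)
  have s: "logd (\<lambda>q. wt1c q / wt1b q) q Y"
    using logd_divide[OF logd_wt1c[OF q(2)] logd_wt1b[OF q(2)] q'(2)]
    by (rule back_subst[where P = "logd _ q"]) (simp add: Y_def field_simps)
  obtain D where D: "((\<lambda>q. wt1a q / wt1b q) has_field_derivative D) (at q)" "q * D = wt1a q / wt1b q * X"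
    using t unfolding logd_def by blast
  have "((\<lambda>q. (wt1a q / wt1b q + 8) / 9) has_field_derivative D / 9) (at q)"
    using DERIV_cdivide[OF DERIV_add[OF D(1) DERIV_const[of 8]], of 9] by simp
  then have "((\<lambda>q. wt1c q / wt1b q) has_field_derivative D / 9) (at q)"
  proof (rule has_field_derivative_transform_within_open[of _ _ _ "ball 0 1 - {0}"])
    fix r :: complex assume "r \<in> ball 0 1 - {0}"
    then show "(wt1a r / wt1b r + 8) / 9 = wt1c r / wt1b r"
      using wt1c_eq[of r] wt1_nonzero[of r] by (simp add: field_simps)
  qed (use q in auto)
  then have *: "q * (D / 9) = wt1c q / wt1b q * Y" by (rule logd_eq[OF s])
  have "wt1a q / wt1b q * X = 9 * (q * (D / 9))" using D(2) by simp
  then have "wt1a q / wt1b q * X = 9 * (wt1c q / wt1b q * Y)" by (simp only: *)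
  then have 1: "wt1a q * X = 9 * wt1c q * Y" using q' by (simp add: field_simps)
  \<comment> \<open>The combination \<open>Y\<close> is itself a(a - b)/9, so a X = 9 c Y becomes a
    X = a c (a - b), and a cancels.\<close>
  have "wt1a q * (wt1a q - wt1b q) = wt1a q ^ 2 - wt1a q * wt1b q"
    by (simp add: power2_eq_square algebra_simps)
  also have "\<dots> = 9 * Y"
    unfolding wt1a_square[OF q] wt1a_wt1b[OF q] Y_def by (simp add: field_simps)
  finally have "wt1a q * (wt1a q - wt1b q) = 9 * Y" .
  with 1 have "wt1a q * X = wt1a q * (wt1c q * (wt1a q - wt1b q))" by (simp add: mult_ac)
  then have "X = wt1c q * (wt1a q - wt1b q)" using q' by simp
  then have "wt1c q * (wt1b q - wt1a q) = - X" by (simp add: algebra_simps)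
  then show ?thesis by (simp add: X_def field_simps)
qed

text \<open>The equation q W' = W says that W/q has derivative 0 on the punctured disc. As W/q
  extends continuously by W'(0), it is constant.\<close>

lemma eq_linear_if_logd_1:
  assumes W: "W holomorphic_on ball 0 1" and W0: "W 0 = 0"
    and ode: "\<And>q. q \<noteq> 0 \<Longrightarrow> norm q < 1 \<Longrightarrow> logd W q 1" and q: "norm q < 1"
  shows "W q = deriv W 0 * q"
proof -
  define R where "R = (\<lambda>z. if z = 0 then deriv W 0 else (W z - W 0) / (z - 0))"
  have "R holomorphic_on ball 0 1"
    unfolding R_def by (rule pole_lemma_open[OF W]) simp
  then have cont: "continuous_on (ball 0 1) R" by (rule holomorphic_on_imp_continuous_on)
  have der: "(R has_field_derivative 0) (at z)" if "z \<in> ball 0 1 - {0}" for z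
  proof -
    have z: "z \<noteq> 0" "norm z < 1" using that by auto
    obtain D where D: "(W has_field_derivative D) (at z)" "z * D = W z * 1"
      using ode[OF z] unfolding logd_def by blast
    have "((\<lambda>z. W z / z) has_field_derivative 0) (at z)"
      using D z by (auto intro!: derivative_eq_intros simp: mult.commute)
    then show ?thesis
      by (rule has_field_derivative_transform_within_open[of _ _ _ "ball 0 1 - {0}"])
        (use that in \<open>auto simp: R_def W0\<close>)
  qed
  obtain c where c: "\<And>z. z \<in> ball 0 1 \<Longrightarrow> R z = c"
    using DERIV_zero_connected_constant[of "ball 0 1" "{0}" R] cont der by auto
  have "R q = R 0" using c[of q] c[of 0] q by simp
  then show ?thesis by (cases "q = 0") (auto simp: R_def W0 field_simps)
qed

lemma wt1d_eq:
  assumes q: "q \<noteq> 0" "norm q < 1"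
  shows "wt1d q = (wt1b q - wt1a q) / 9"
proof -
  \<comment> \<open>\<open>G\<close> is \<open>wt1d\<close> without its factor \<open>q\<close>,
    hence nonzero also at 0. The aim is that \<open>W\<close>, which is (b - a)/(9G), equals
    \<open>q\<close>.\<close>
  define G where "G = (\<lambda>q. euler_pow 6 q ^ 6 * euler_pow 1 q / (euler_pow 2 q ^ 2 * euler_pow 3 q ^ 3))"
  define W where "W = (\<lambda>q. (wt1b q - wt1a q) / 9 / G q)"
  have Gnz: "G q \<noteq> 0" if "norm q < 1" for q
    using euler_pow_nonzero[OF that] by (simp add: G_def)
  have dG: "wt1d q = q * G q" for q by (simp add: wt1d_def G_def)
  have G: "G holomorphic_on ball 0 1"
    unfolding G_def by (intro holomorphic_intros euler_pow_holomorphic) (auto simp: euler_pow_nonzero)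
  have W: "W holomorphic_on ball 0 1"
    unfolding W_def by (intro holomorphic_intros wt1_holomorphic G) (use Gnz in auto)
  have e0: "euler_pow k 0 = 1" if "k > 0" for k
    using that by (simp add: euler_pow_def euler_def qprod_def power_0_left)
  have "logd W q 1" if q: "q \<noteq> 0" "norm q < 1" for q
  proof -
    \<comment> \<open>\<open>v\<close> is (b - a)/(9b). By \<open>wt1c_diff\<close> its logarithmic
      derivative is the product ac, a combination of the \<open>P_pow\<close>. Off 0,
      \<open>W\<close> is v b q / d, and all \<open>P_pow\<close> cancel in its logarithmic
      derivative, leaving 1.\<close>
    define v where "v = (\<lambda>q. (1 - wt1a q / wt1b q) / 9)"
    define X where "X = (9 * P_pow 1 q - 9 * P_pow 2 q - 3 * P_pow 3 q + 3 * P_pow 6 q) / 24"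
    have t: "logd (\<lambda>q. wt1a q / wt1b q) q X"
      using logd_divide[OF logd_wt1a[OF q(2)] logd_wt1b[OF q(2)] wt1_nonzero(2)[OF q(2)]]
      by (rule back_subst[where P = "logd _ q"]) (simp add: X_def field_simps)
    then obtain D where D: "((\<lambda>q. wt1a q / wt1b q) has_field_derivative D) (at q)"
      "q * D = wt1a q / wt1b q * X"
      unfolding logd_def by blast
    have "X = - (wt1c q * (wt1b q - wt1a q))" by (simp add: X_def wt1c_diff[OF q] field_simps)
    then have "q * (- D / 9) = (wt1a q / wt1b q) * (wt1c q * (wt1b q - wt1a q)) / 9"
      using D(2) by simp
    also have "\<dots> = v q * (wt1a q * wt1c q)"
      using wt1_nonzero[OF q(2)] by (simp add: v_def field_simps)
    finally have "q * (- D / 9) = v q * (wt1a q * wt1c q)" .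
    moreover have "(v has_field_derivative - D / 9) (at q)"
      unfolding v_def using DERIV_cdivide[OF DERIV_diff[OF DERIV_const[of 1] D(1)], of 9] by simp
    ultimately have v: "logd v q (wt1a q * wt1c q)" unfolding logd_def by blast
    have "logd (\<lambda>q. v q * wt1b q * q / wt1d q) q
      (wt1a q * wt1c q + (6 * P_pow 2 q + P_pow 3 q - 3 * P_pow 1 q - 2 * P_pow 6 q) / 24 + 1
        - (6 * P_pow 6 q + P_pow 1 q - 2 * P_pow 2 q - 3 * P_pow 3 q) / 24)"
      by (intro logd_divide logd_mult v logd_wt1b logd_wt1d logd_ident q)
        (use q Gnz in \<open>simp add: dG\<close>)
    then have "logd (\<lambda>q. v q * wt1b q * q / wt1d q) q 1"
      by (rule back_subst[where P = "logd _ q"]) (simp add: wt1a_wt1c[OF q] field_simps)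
    then obtain D' where D': "((\<lambda>q. v q * wt1b q * q / wt1d q) has_field_derivative D') (at q)"
      "q * D' = v q * wt1b q * q / wt1d q * 1" unfolding logd_def by blast
    have W_eq: "v r * wt1b r * r / wt1d r = W r" if "r \<in> ball 0 1 - {0}" for r
      using that wt1_nonzero[of r] Gnz[of r] by (simp add: dG W_def v_def field_simps)
    have "(W has_field_derivative D') (at q)"
      by (rule has_field_derivative_transform_within_open[OF D'(1), of "ball 0 1 - {0}"])
        (use W_eq q in auto)
    with D'(2) W_eq[of q] q show ?thesis unfolding logd_def by auto
  qed
  moreover have "W 0 = 0" by (simp add: W_def wt1a_def wt1b_def e0)
  ultimately have lin: "W q = deriv W 0 * q"
    using q W by (intro eq_linear_if_logd_1) auto
  \<comment> \<open>To first order at 0 only \<open>euler_pow 1\<close> contributes: its exponents 6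
    in a and -3 in b give the derivatives -6 and 3, so W'(0) = (3 + 6)/9 = 1.\<close>
  have d1: "(euler_pow 1 has_field_derivative - 1) (at 0)"
    using euler_pow_has_field_derivative[of 0 1] euler_deriv_0 by simp
  have dk: "(euler_pow k has_field_derivative 0) (at 0)" if "k > 1" for k
    using euler_pow_has_field_derivative[of 0 k] that by (simp add: power_0_left)
  note d = d1 dk[of 2, simplified] dk[of 3, simplified] dk[of 6, simplified]
  have "(wt1a has_field_derivative - 6) (at 0)"
    unfolding wt1a_def[abs_def] by (rule derivative_eq_intros d refl | simp add: e0)+
  moreover have "(wt1b has_field_derivative 3) (at 0)"
    unfolding wt1b_def[abs_def] by (rule derivative_eq_intros d refl | simp add: e0)+
  moreover have "(G has_field_derivative deriv G 0) (at 0)"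
    by (rule holomorphic_derivI[OF G]) auto
  moreover have "G 0 = 1" "wt1a 0 = 1" "wt1b 0 = 1"
    by (simp_all add: G_def wt1a_def wt1b_def e0)
  ultimately have "(W has_field_derivative 1) (at 0)"
    unfolding W_def by (auto intro!: derivative_eq_intros)
  then have "deriv W 0 = 1" by (rule DERIV_imp_deriv)
  then show ?thesis using lin Gnz[OF q(2)] by (simp add: W_def dG field_simps)
qed

section \<open>Eisenstein series of level 6\<close>

text \<open>Evaluated at \<open>q^2\<close>, this is the series E; \<open>eis'\<close> and
  \<open>eis''\<close> are likewise S and T.\<close>

definition eis :: "complex \<Rightarrow> complex" where
  "eis q = (P_pow 6 q - P_pow 3 q + P_pow 2 q - P_pow 1 q) / 4"

definition eis' :: "complex \<Rightarrow> complex" where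
  "eis' q = (P_pow 6 q + P_pow 3 q - P_pow 2 q - P_pow 1 q) / 6"

definition eis'' :: "complex \<Rightarrow> complex" where
  "eis'' q = (P_pow 6 q - P_pow 3 q - P_pow 2 q + P_pow 1 q) / 2"

text \<open>The form h as a function of Q, a cusp form of weight 4 and level 6;
  \<open>cusp4 (q^2)\<close> is the square of the eta product.\<close>

definition cusp4 :: "complex \<Rightarrow> complex" where
  "cusp4 q = q * (euler_pow 1 q * euler_pow 2 q * euler_pow 3 q * euler_pow 6 q)\<^sup>2"

lemma wt1_prod:
  assumes "norm q < 1"
  shows "wt1a q * wt1b q * wt1c q * wt1d q = cusp4 q"
  using euler_pow_nonzero[OF assms]
  by (simp add: wt1a_def wt1b_def wt1c_def wt1d_def cusp4_def divide_simps) 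
    (simp add: power2_eq_square eval_nat_numeral mult_ac)

text \<open>The linear relations make ab, cd, ad and bc explicit in the \<open>P_pow\<close>, which
  gives E = bc + ad = ab + 9cd. With abcd = h, both squares are instances of (u + v)^2 - 4uv = (u -
  v)^2.\<close>

lemma
  assumes q: "q \<noteq> 0" "norm q < 1"
  shows eis_eq: "eis q = wt1b q * wt1c q + wt1a q * wt1d q"
    and eis'_eq: "eis' q = wt1b q * wt1c q - wt1a q * wt1d q"
    and eis_square: "(eis q)\<^sup>2 - 4 * cusp4 q = (eis' q)\<^sup>2" "(eis q)\<^sup>2 - 36 * cusp4 q = (eis'' q)\<^sup>2"
proof -
  define a b c d where "a = wt1a q" and "b = wt1b q" and "c = wt1c q" and "d = wt1d q"
  define p1 p2 p3 p6 where "p1 = P_pow 1 q" and "p2 = P_pow 2 q" and "p3 = P_pow 3 q" and "p6 = P_pow 6 q"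
  note defs = a_def b_def c_def d_def p1_def p2_def p3_def p6_def
  have aa: "a ^ 2 = (p1 - 4 * p2 + 3 * p3) / 2" and ab: "a * b = (p1 - p2 - 3 * p3 + 3 * p6) / 8"
    unfolding defs by (rule wt1a_square wt1a_wt1b, fact q, fact q)+
  have a: "a = b - 9 * d" and c: "c = b - d"
    unfolding defs wt1c_eq[OF q] wt1d_eq[OF q] by (simp_all add: field_simps)
  have "c * d = c * (b - a) / 9" by (simp add: a)
  also have "c * (b - a) = (- 9 * p1 + 9 * p2 + 3 * p3 - 3 * p6) / 24"
    unfolding defs by (rule wt1c_diff[OF q])
  also have "\<dots> / 9 = (- 3 * p1 + 3 * p2 + p3 - p6) / 72"
    by (simp add: field_simps)
  finally have cd: "c * d = (- 3 * p1 + 3 * p2 + p3 - p6) / 72" .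
  have ad: "a * d = (a * b - a ^ 2) / 9"
    by (simp add: a power2_eq_square algebra_simps)
  have ad': "a * d = (- p1 + 5 * p2 - 5 * p3 + p6) / 24"
    unfolding ad aa ab by (simp add: field_simps)
  have "b * c = a * b + 9 * (c * d) - a * d"
    by (simp add: a c algebra_simps)
  also have "\<dots> = (- 5 * p1 + p2 - p3 + 5 * p6) / 24"
    unfolding ab cd ad' by (simp add: field_simps)
  finally have bc: "b * c = (- 5 * p1 + p2 - p3 + 5 * p6) / 24" .
  have h: "cusp4 q = a * b * c * d" using wt1_prod[OF q(2)] by (simp add: defs)
  have e: "eis q = b * c + a * d" "eis' q = b * c - a * d" "eis q = a * b + 9 * (c * d)"
     "eis'' q = a * b - 9 * (c * d)"
    unfolding ab ad' bc cd by (simp_all add: eis_def eis'_def eis''_def p1_def p2_def p3_def p6_def field_simps)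
  show "eis q = wt1b q * wt1c q + wt1a q * wt1d q" "eis' q = wt1b q * wt1c q - wt1a q * wt1d q"
    using e by (simp_all add: defs)
  show "(eis q)\<^sup>2 - 4 * cusp4 q = (eis' q)\<^sup>2"
    unfolding e(1,2) h by (simp add: power2_eq_square algebra_simps)
  show "(eis q)\<^sup>2 - 36 * cusp4 q = (eis'' q)\<^sup>2"
    unfolding e(3,4) h by (simp add: power2_eq_square algebra_simps)
qed

text \<open>Differentiate E = bc + ad. Half the sum of the logarithmic derivatives \<open>L1\<close>
  and \<open>L2\<close> multiplies E, half their difference multiplies S; here
  \<open>L1 + L2\<close> is D log h and \<open>L1 - L2\<close> is -T.\<close>

lemma eis_derivative:
  assumes q: "q \<noteq> 0" "norm q < 1" and D: "(eis has_field_derivative D) (at q)"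
  shows "2 * (q * D) = (P_pow 1 q + P_pow 2 q + P_pow 3 q + P_pow 6 q) / 12 * eis q - eis' q * eis'' q"
proof -
  define L1 where "L1 = (- 5 * P_pow 1 q + 7 * P_pow 2 q + 7 * P_pow 3 q - 5 * P_pow 6 q) / 24"
  define L2 where "L2 = (7 * P_pow 1 q - 5 * P_pow 2 q - 5 * P_pow 3 q + 7 * P_pow 6 q) / 24"
  have "logd (\<lambda>q. wt1b q * wt1c q) q L1"
    using logd_mult[OF logd_wt1b[OF q(2)] logd_wt1c[OF q(2)]]
    by (rule back_subst[where P = "logd _ q"]) (simp add: L1_def field_simps)
  then obtain D1 where D1: "((\<lambda>q. wt1b q * wt1c q) has_field_derivative D1) (at q)"
    "q * D1 = wt1b q * wt1c q * L1" unfolding logd_def by blast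
  have "logd (\<lambda>q. wt1a q * wt1d q) q L2"
    using logd_mult[OF logd_wt1a[OF q(2)] logd_wt1d[OF q(2)]]
    by (rule back_subst[where P = "logd _ q"]) (simp add: L2_def field_simps)
  then obtain D2 where D2: "((\<lambda>q. wt1a q * wt1d q) has_field_derivative D2) (at q)"
    "q * D2 = wt1a q * wt1d q * L2" unfolding logd_def by blast
  have "(eis has_field_derivative D1 + D2) (at q)"
    by (rule has_field_derivative_transform_within_open[OF DERIV_add[OF D1(1) D2(1)], of "ball 0 1 - {0}"])
      (use q eis_eq in auto)
  then have "D = D1 + D2" using D DERIV_unique by blast
  then have "2 * (q * D) = 2 * (wt1b q * wt1c q * L1 + wt1a q * wt1d q * L2)"
    by (simp add: ring_distribs D1(2) D2(2))
  also have "\<dots> = (L1 + L2) * (wt1b q * wt1c q + wt1a q * wt1d q) +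
      (L1 - L2) * (wt1b q * wt1c q - wt1a q * wt1d q)"
    by (simp add: algebra_simps)
  also have "L1 - L2 = - eis'' q" by (simp add: L1_def L2_def eis''_def field_simps)
  also have "L1 + L2 = (P_pow 1 q + P_pow 2 q + P_pow 3 q + P_pow 6 q) / 12"
    by (simp add: L1_def L2_def field_simps)
  finally show ?thesis by (simp add: eis_eq[OF q] eis'_eq[OF q])
qed

section \<open>The differential equation\<close>

lemma nome_of_nat_mult: "nome (of_nat n * \<tau>) = nome \<tau> ^ n"
  unfolding nome_def by (simp flip: exp_of_nat_mult add: mult_ac)

definition cusp2 :: "complex \<Rightarrow> complex" where
  "cusp2 q = q * (euler_pow 1 (q\<^sup>2) * euler_pow 2 (q\<^sup>2) * euler_pow 3 (q\<^sup>2) * euler_pow 6 (q\<^sup>2))"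

definition zq :: "complex \<Rightarrow> complex" where
  "zq q = eis (q\<^sup>2) + 2 * cusp2 q"

lemma eta_prod_eq: "eta_prod \<tau> = cusp2 (nome \<tau>)"
proof -
  have n: "nome (2 * \<tau>) = nome \<tau> ^ 2" "nome (4 * \<tau>) = nome \<tau> ^ 4"
    "nome (6 * \<tau>) = nome \<tau> ^ 6" "nome (12 * \<tau>) = nome \<tau> ^ 12"
    using nome_of_nat_mult[of 2 \<tau>] nome_of_nat_mult[of 4 \<tau>] nome_of_nat_mult[of 6 \<tau>]
      nome_of_nat_mult[of 12 \<tau>] by simp_all
  let ?E = "\<lambda>k::complex. exp (2 * of_real pi * \<i> * (k * \<tau>) / 24)"
  \<comment> \<open>The exponents add up to (2 + 4 + 6 + 12)/24 = 1, so the fractional powers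
    combine to a single factor \<open>q\<close>.\<close>
  have E: "?E 2 * ?E 4 * ?E 6 * ?E 12 = nome \<tau>"
    unfolding nome_def exp_add[symmetric] by (rule arg_cong[where f = exp]) (simp add: field_simps)
  have e: "(\<Prod>j. 1 - (nome \<tau> ^ (2 * k)) ^ Suc j) = euler_pow k (nome \<tau> ^ 2)" for k
    by (simp add: euler_pow_def euler_def qprod_def flip: power_mult)
  have "eta_prod \<tau> = (?E 2 * ?E 4 * ?E 6 * ?E 12) *
      (euler_pow 1 (nome \<tau> ^ 2) * euler_pow 2 (nome \<tau> ^ 2) * euler_pow 3 (nome \<tau> ^ 2) *
        euler_pow 6 (nome \<tau> ^ 2))"
    unfolding e[symmetric] eta_prod_def dedekind_eta_def n by (simp del: power_Suc)
  then show ?thesis by (simp only: E cusp2_def)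
qed

lemma z_fun_eq: "z_fun \<tau> = zq (nome \<tau>)"
proof -
  have "(nome \<tau> ^ 2) ^ k = nome \<tau> ^ (2 * k)" for k by (simp add: power_mult)
  then show ?thesis
    by (simp add: z_fun_def Let_def zq_def eta_prod_eq eis_def P_pow_def)
qed

lemma square_norm_less_one: "norm (q::complex) < 1 \<Longrightarrow> norm (q\<^sup>2) < 1"
  by (rule power_norm_less_one) auto

lemma holomorphic_on_compose_square:
  assumes "f holomorphic_on ball 0 1"
  shows "(\<lambda>q. f (q\<^sup>2)) holomorphic_on ball 0 1"
  using holomorphic_on_compose_gen[of "\<lambda>q. q\<^sup>2" "ball 0 1" f "ball 0 1"] assms square_norm_less_one
  by (force simp: o_def intro: holomorphic_intros)

lemma eis_holomorphic: "eis holomorphic_on ball 0 1" "eis' holomorphic_on ball 0 1"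
  "eis'' holomorphic_on ball 0 1"
  unfolding eis_def[abs_def] eis'_def[abs_def] eis''_def[abs_def]
  by (intro holomorphic_intros P_pow_holomorphic; simp)+

lemma cusp2_holomorphic: "cusp2 holomorphic_on ball 0 1"
  unfolding cusp2_def[abs_def]
  by (intro holomorphic_intros holomorphic_on_compose_square euler_pow_holomorphic) auto

lemma zq_holomorphic: "zq holomorphic_on ball 0 1"
  unfolding zq_def[abs_def]
  by (intro holomorphic_intros holomorphic_on_compose_square eis_holomorphic cusp2_holomorphic)

lemma logd_compose_square:
  assumes "logd f (q\<^sup>2) L"
  shows "logd (\<lambda>q. f (q\<^sup>2)) q (2 * L)"
proof -
  obtain D where D: "(f has_field_derivative D) (at (q\<^sup>2))" "q\<^sup>2 * D = f (q\<^sup>2) * L"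
    using assms unfolding logd_def by blast
  have "((\<lambda>q. q\<^sup>2) has_field_derivative 2 * q) (at q)"
    by (auto intro!: derivative_eq_intros)
  then have "((\<lambda>q. f (q\<^sup>2)) has_field_derivative D * (2 * q)) (at q)"
    by (rule DERIV_chain2[where f = f and g = "\<lambda>q. q\<^sup>2", OF D(1)])
  moreover have "q * (D * (2 * q)) = f (q\<^sup>2) * (2 * L)"
    using D(2) by (simp add: power2_eq_square mult_ac)
  ultimately show ?thesis unfolding logd_def by blast
qed

text \<open>The expression is the one in \<open>eis_derivative\<close>: f is a square root of h, and
  q d/dq is twice D.\<close>

lemma logd_cusp2:
  assumes "norm q < 1"
  shows "logd cusp2 q ((P_pow 1 (q\<^sup>2) + P_pow 2 (q\<^sup>2) + P_pow 3 (q\<^sup>2) + P_pow 6 (q\<^sup>2)) / 12)"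
proof -
  define l where "l k = (P_pow k (q\<^sup>2) - of_nat k) / 24" for k
  have l: "logd (\<lambda>q. euler_pow k (q\<^sup>2)) q (2 * l k)" if "k > 0" for k
    unfolding l_def by (intro logd_compose_square logd_euler_pow square_norm_less_one assms that)
  have "logd cusp2 q (1 + (2 * l 1 + 2 * l 2 + 2 * l 3 + 2 * l 6))"
    unfolding cusp2_def[abs_def] by (intro logd_mult logd_ident l) auto
  then show ?thesis
    by (rule back_subst[where P = "logd cusp2 q"]) (simp add: l_def field_simps)
qed

text \<open>In the quotient rule for f/z with z = E + 2f, all terms containing the logarithmic
  derivative \<open>L\<close> cancel and f S T / z^2 remains.\<close>

lemma zq_x_ode:
  assumes q: "q \<noteq> 0" "norm q < 1" and z: "zq q \<noteq> 0"
  shows "q * deriv (\<lambda>q. cusp2 q / zq q) q =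
    zq q * (cusp2 q / zq q) * (eis' (q\<^sup>2) * eis'' (q\<^sup>2) / (zq q)\<^sup>2)"
proof -
  define L where "L = (P_pow 1 (q\<^sup>2) + P_pow 2 (q\<^sup>2) + P_pow 3 (q\<^sup>2) + P_pow 6 (q\<^sup>2)) / 12"
  have q2: "q\<^sup>2 \<noteq> 0" "norm (q\<^sup>2) < 1" using q square_norm_less_one by auto
  obtain F where F: "(cusp2 has_field_derivative F) (at q)" "q * F = cusp2 q * L"
    using logd_cusp2[OF q(2)] unfolding logd_def L_def by blast
  obtain D where D: "(eis has_field_derivative D) (at (q\<^sup>2))"
    using holomorphic_derivI[OF eis_holomorphic(1), of "q\<^sup>2"] q2 by auto
  have DE: "2 * (q\<^sup>2 * D) = L * eis (q\<^sup>2) - eis' (q\<^sup>2) * eis'' (q\<^sup>2)"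
    unfolding L_def by (rule eis_derivative[OF q2 D])
  have "((\<lambda>q. q\<^sup>2) has_field_derivative 2 * q) (at q)"
    by (auto intro!: derivative_eq_intros)
  from DERIV_chain2[where f = eis and g = "\<lambda>q. q\<^sup>2", OF D this]
  have "((\<lambda>q. eis (q\<^sup>2)) has_field_derivative D * (2 * q)) (at q)" .
  then have Z: "(zq has_field_derivative D * (2 * q) + 2 * F) (at q)"
    unfolding zq_def[abs_def] by (intro DERIV_add DERIV_cmult F(1))
  have "deriv (\<lambda>q. cusp2 q / zq q) q = (F * zq q - cusp2 q * (D * (2 * q) + 2 * F)) / (zq q * zq q)"
    by (rule DERIV_imp_deriv[OF DERIV_divide[OF F(1) Z z]])
  then have "q * deriv (\<lambda>q. cusp2 q / zq q) q =
      ((q * F) * zq q - cusp2 q * (2 * (q\<^sup>2 * D) + 2 * (q * F))) / (zq q * zq q)"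
    by (simp add: algebra_simps power2_eq_square)
  also have "(q * F) * zq q - cusp2 q * (2 * (q\<^sup>2 * D) + 2 * (q * F)) =
      cusp2 q * (eis' (q\<^sup>2) * eis'' (q\<^sup>2))"
    unfolding F(2) DE zq_def by (simp add: algebra_simps)
  finally show ?thesis using z by (simp add: power2_eq_square)
qed

lemma zq_x_square:
  assumes q: "q \<noteq> 0" "norm q < 1" and z: "zq q \<noteq> 0"
  defines "x \<equiv> cusp2 q / zq q"
  shows "(eis' (q\<^sup>2) * eis'' (q\<^sup>2) / (zq q)\<^sup>2)\<^sup>2 = (1 + 4 * x) * (1 - 4 * x) * (1 - 8 * x)"
proof -
  have q2: "q\<^sup>2 \<noteq> 0" "norm (q\<^sup>2) < 1" using q square_norm_less_one by auto
  define E f where "E = eis (q\<^sup>2)" and "f = cusp2 q"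
  have h: "cusp4 (q\<^sup>2) = f\<^sup>2"
    by (simp add: cusp4_def cusp2_def f_def power_mult_distrib)
  have zE: "zq q = E + 2 * f" by (simp add: zq_def E_def f_def)
  have "(eis' (q\<^sup>2) * eis'' (q\<^sup>2) / (zq q)\<^sup>2)\<^sup>2 =
      ((E\<^sup>2 - 4 * f\<^sup>2) * (E\<^sup>2 - 36 * f\<^sup>2)) / (zq q) ^ 4"
    using eis_square[OF q2] by (simp add: power_divide power_mult_distrib E_def h)
  \<comment> \<open>With E = z - 2f the four linear factors E + 2f, E - 2f, E + 6f, E - 6f are z, z
    - 4f, z + 4f, z - 8f.\<close>
  also have "(E\<^sup>2 - 4 * f\<^sup>2) * (E\<^sup>2 - 36 * f\<^sup>2) =
     zq q * ((zq q + 4 * f) * (zq q - 4 * f) * (zq q - 8 * f))"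
    unfolding zE by (simp add: algebra_simps power2_eq_square)
  also have "\<dots> / (zq q) ^ 4 = (1 + 4 * x) * (1 - 4 * x) * (1 - 8 * x)"
  proof -
    have "1 + 4 * x = (zq q + 4 * f) / zq q" "1 - 4 * x = (zq q - 4 * f) / zq q"
      "1 - 8 * x = (zq q - 8 * f) / zq q"
      using z by (simp_all add: x_def f_def field_simps)
    then show ?thesis using z by (simp add: power4_eq_xxxx)
  qed
  finally show ?thesis .
qed

lemma zq_eis_0: "zq 0 = 1" "eis' 0 = 1" "eis'' 0 = 1" "cusp2 0 = 0"
  by (simp_all add: zq_def eis_def eis'_def eis''_def cusp2_def P_pow_def ramanujan_P_def)

text \<open>\<open>x_fun\<close> and \<open>z_fun\<close> depend on \<tau>, so the derivative in q
  is taken of holomorphic functions near 0 that agree with them under \<open>nome\<close>. Because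
  \<open>x 0 = 0\<close>, the radicand is 1 at 0 and the principal \<open>csqrt\<close> is the
  required branch there.\<close>

theorem theorem3p2:
  shows "\<exists>r>0. \<exists>x z :: complex \<Rightarrow> complex.
    x holomorphic_on ball 0 r \<and> z holomorphic_on ball 0 r \<and> x 0 = 0 \<and>
    (\<forall>\<tau>. Im \<tau> > 0 \<and> nome \<tau> \<in> ball 0 r \<longrightarrow>
       z_fun \<tau> \<noteq> 0 \<and> z (nome \<tau>) = z_fun \<tau> \<and> x (nome \<tau>) = x_fun \<tau>) \<and>
    (\<forall>q\<in>ball 0 r. q * deriv x q =
       z q * x q * csqrt ((1 + 4 * x q) * (1 - 4 * x q) * (1 - 8 * x q)))"
proof -
  define x where "x = (\<lambda>q. cusp2 q / zq q)"
  define g where "g = (\<lambda>q. eis' (q\<^sup>2) * eis'' (q\<^sup>2) / (zq q)\<^sup>2)"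
  have cz: "isCont zq 0"
    using holomorphic_on_imp_continuous_on[OF zq_holomorphic]
    by (simp add: continuous_on_eq_continuous_at)
  have "isCont (\<lambda>q. eis' (q\<^sup>2)) 0" "isCont (\<lambda>q. eis'' (q\<^sup>2)) 0"
    using holomorphic_on_compose_square[OF eis_holomorphic(2)]
      holomorphic_on_compose_square[OF eis_holomorphic(3)]
    by (auto dest!: holomorphic_on_imp_continuous_on simp: continuous_on_eq_continuous_at)
  then have "isCont g 0"
    unfolding g_def using cz by (intro continuous_intros) (auto simp: zq_eis_0)
  \<comment> \<open>\<open>g\<close>, that is S T / z^2, squares to the radicand. Since it tends to
    1, its real part is positive near 0, which identifies it with \<open>csqrt\<close>.\<close>
  then have "(g \<longlongrightarrow> 1) (nhds 0)" "(zq \<longlongrightarrow> 1) (nhds 0)"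
    using cz by (simp_all add: isCont_def tendsto_nhds_iff g_def zq_eis_0)
  from tendstoD[OF this(1), of 1] tendstoD[OF this(2), of 1]
  have "eventually (\<lambda>q. dist (g q) 1 < 1 \<and> dist (zq q) 1 < 1) (nhds 0)"
    by (simp add: eventually_conj)
  then obtain r0 where r0: "r0 > 0" "\<And>q. dist q 0 < r0 \<Longrightarrow> dist (g q) 1 < 1 \<and> dist (zq q) 1 < 1"
    unfolding eventually_nhds_metric by blast
  define r where "r = min r0 1"
  have z: "zq q \<noteq> 0" and g: "0 < Re (g q)" and q1: "norm q < 1" if "q \<in> ball 0 r" for q
  proof -
    have *: "dist (g q) 1 < 1" "dist (zq q) 1 < 1" "norm q < 1"
      using that r0(2)[of q] by (auto simp: r_def)
    then show "zq q \<noteq> 0" "norm q < 1" by auto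
    have "\<bar>Re (g q - 1)\<bar> < 1"
      using abs_Re_le_cmod[of "g q - 1"] *(1) by (simp add: dist_norm)
    then show "0 < Re (g q)" by simp
  qed
  have sub: "ball 0 r \<subseteq> (ball 0 1 :: complex set)" by (auto simp: r_def)
  show ?thesis
  proof (rule exI[of _ r], rule conjI[rotated], rule exI[of _ x], rule exI[of _ zq],
      intro conjI allI ballI impI)
    show "r > 0" using r0 by (simp add: r_def)
    show "x holomorphic_on ball 0 r"
      unfolding x_def using z
      by (intro holomorphic_intros holomorphic_on_subset[OF cusp2_holomorphic sub]
          holomorphic_on_subset[OF zq_holomorphic sub]) auto
    show "zq holomorphic_on ball 0 r" by (rule holomorphic_on_subset[OF zq_holomorphic sub])
    show "x 0 = 0" by (simp add: x_def zq_eis_0)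
  next
    fix \<tau> assume \<tau>: "0 < Im \<tau> \<and> nome \<tau> \<in> ball 0 r"
    show "z_fun \<tau> \<noteq> 0" using \<tau> z by (simp add: z_fun_eq)
    show "zq (nome \<tau>) = z_fun \<tau>" "x (nome \<tau>) = x_fun \<tau>"
      by (simp_all add: z_fun_eq x_fun_def x_def eta_prod_eq)
  next
    fix q :: complex assume q: "q \<in> ball 0 r"
    show "q * deriv x q = zq q * x q * csqrt ((1 + 4 * x q) * (1 - 4 * x q) * (1 - 8 * x q))"
    proof (cases "q = 0")
      case False
      have "csqrt ((1 + 4 * x q) * (1 - 4 * x q) * (1 - 8 * x q)) = g q"
        using zq_x_square[OF False q1[OF q] z[OF q]] g[OF q]
        by (intro csqrt_unique) (auto simp: g_def x_def)
      then show ?thesis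
        using zq_x_ode[OF False q1[OF q] z[OF q]] by (simp add: g_def x_def)
    \<comment> \<open>At \<open>q = 0\<close> both sides vanish, the right one because
      \<open>cusp2 0 = 0\<close>.\<close>
    qed (simp add: x_def zq_eis_0)
  qed
qed

end
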